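(* There is an isomorphism of $\mathbb Z[\nu^{\pm1}]$-algebras $$\kappa:\mathcal A(2,2)\longrightarrow\mathcal A(\varLambda,B),\qquad X_{V(l)}\longmapsto X_{\mathcal O(-l)}\quad(l\in\mathbb Z),$$ from the quantum cluster algebra of the Kronecker quiver to the quantum cluster algebra of $\mathbb P^1$.
   Context: Let $\nu$ be a formal variable and $\varLambda=\begin{bmatrix}0&-1\\1&0\end{bmatrix}$, $\varLambda(\alpha,\beta)=\alpha^t\varLambda\beta$, $B=\begin{bmatrix}0&-2\\2&0\end{bmatrix}$. $\mathcal T_\varLambda$ is the $\mathbb Z[\nu^{\pm1}]$-algebra with basis $X^\alpha$ ($\alpha\in\mathbb Z^2$) and product $X^\alpha X^\beta=\nu^{\varLambda(\alpha,\beta)}X^{\alpha+\beta}$; $x_1=X^{(1,0)}$, $x_2=X^{(0,1)}$. $\hat{\mathcal T}_\varLambda\supset\mathcal T_\varLambda$ is the algebra of formal sums $\sum c_\alpha X^\alpha$ whose support is bounded above in both coordinates, with the same product rule. $\mathcal A(2,2)$ is the $\mathbb Z[\nu^{\pm1}]$-subalgebra of $\mathcal T_\varLambda$ generated by the elements $X_{V(l)}$, $l\in\mathbb Z$, determined by $X_{V(1)}=x_2$, $X_{V(2)}=x_1$ and the relations $X_{V(l-2)}X_{V(l)}=\nu^2X_{V(l-1)}^2+1$, $l\in\mathbb Z$; they also satisfy $X_{V(l-1)}X_{V(l)}=\nu^2X_{V(l)}X_{V(l-1)}$. (For $l\neq1,2$, $X_{V(l)}$ is the quantum cluster character of an indecomposable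 preprojective or preinjective Kronecker module.) $\mathcal A(\varLambda,B)$ is the $\mathbb Z[\nu^{\pm1}]$-subalgebra of $\hat{\mathcal T}_\varLambda$ generated by, for $l\in\mathbb Z$, $$X_{\mathcal O(l)}=X^{-(l+1,-1)}+\sum_{r\ge -l}\nu^{-2(l+r)}\frac{\nu^{4(l+r+1)}-1}{\nu^4-1}\,X^{-(l+2r+1,1)}.$$ *)

theory Defs
  imports Complex_Main "HOL-Library.Poly_Mapping" "HOL-Library.Product_Plus"
begin

section \<open>The ground ring of integral Laurent polynomials\<close>

text \<open>Finitely supported functions \<^typ>\<open>int \<Rightarrow> int\<close> with the convolution product of
  \<^theory>\<open>HOL-Library.Poly_Mapping\<close>, i.e. the group ring of the integers.\<close>

type_synonym laurent = "int \<Rightarrow>\<^sub>0 int"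

definition nu_pow :: "int \<Rightarrow> laurent"  (\<open>\<nu>\<^bsup>_\<^esup>\<close>)
  where "\<nu>\<^bsup>k\<^esup> = Poly_Mapping.single k 1"

lemma nu_pow_0 [simp]: "\<nu>\<^bsup>0\<^esup> = 1"
  by (simp add: nu_pow_def)

lemma nu_pow_mult: "\<nu>\<^bsup>j\<^esup> * \<nu>\<^bsup>k\<^esup> = \<nu>\<^bsup>j + k\<^esup>"
  by (simp add: nu_pow_def mult_single)

lemma nu_pow_eq_iff [simp]: "\<nu>\<^bsup>j\<^esup> = \<nu>\<^bsup>k\<^esup> \<longleftrightarrow> j = k"
  unfolding nu_pow_def by (metis lookup_single_eq lookup_single_not_eq one_neq_zero)

text \<open>The exact quotient of two Laurent polynomials; it is meaningful when the second is nonzero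
  and divides the first.\<close>

definition exact_quotient :: "laurent \<Rightarrow> laurent \<Rightarrow> laurent"
  where "exact_quotient a b = (THE q. q * b = a)"

lemma exact_quotient_eq:
  assumes "q * b = a" and "b \<noteq> 0"
  shows "exact_quotient a b = q"
  unfolding exact_quotient_def using assms by (intro the_equality) auto

lemma exact_quotient_nu:
  "exact_quotient (\<nu>\<^bsup>4 * (int n + 1)\<^esup> - 1) (\<nu>\<^bsup>4\<^esup> - 1) = (\<Sum>k\<le>n. \<nu>\<^bsup>4 * int k\<^esup>)"
proof (rule exact_quotient_eq)
  show "(\<Sum>k\<le>n. \<nu>\<^bsup>4 * int k\<^esup>) * (\<nu>\<^bsup>4\<^esup> - 1) = \<nu>\<^bsup>4 * (int n + 1)\<^esup> - 1"
    by (induction n) (simp_all add: algebra_simps nu_pow_mult)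
  show "\<nu>\<^bsup>4\<^esup> - 1 \<noteq> 0"
    using nu_pow_eq_iff[of 4 0] by (simp del: nu_pow_eq_iff)
qed

section \<open>The completed quantum torus\<close>

text \<open>The skew form \<open>\<alpha>\<^sup>t \<Lambda> \<beta>\<close> for the matrix \<open>\<Lambda>\<close> with rows \<open>(0, -1)\<close> and \<open>(1, 0)\<close>.\<close>

definition Lam :: "int \<times> int \<Rightarrow> int \<times> int \<Rightarrow> int"
  where "Lam \<alpha> \<beta> = snd \<alpha> * fst \<beta> - fst \<alpha> * snd \<beta>"

lemma Lam_simps [simp]:
  "Lam 0 \<beta> = 0" "Lam \<alpha> 0 = 0" "Lam \<alpha> \<alpha> = 0"
  by (simp_all add: Lam_def)

definition bdd_supp :: "(int \<times> int \<Rightarrow> laurent) \<Rightarrow> bool"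
  where "bdd_supp f \<longleftrightarrow> (\<exists>M N. \<forall>\<alpha>. f \<alpha> \<noteq> 0 \<longrightarrow> fst \<alpha> \<le> M \<and> snd \<alpha> \<le> N)"

text \<open>For supports bounded above, the index set of the following sum is finite.\<close>

definition twisted_conv ::
  "(int \<times> int \<Rightarrow> laurent) \<Rightarrow> (int \<times> int \<Rightarrow> laurent) \<Rightarrow> (int \<times> int \<Rightarrow> laurent)"
  where "twisted_conv f g \<gamma> =
    (\<Sum>\<alpha> | f \<alpha> \<noteq> 0 \<and> g (\<gamma> - \<alpha>) \<noteq> 0. \<nu>\<^bsup>Lam \<alpha> (\<gamma> - \<alpha>)\<^esup> * f \<alpha> * g (\<gamma> - \<alpha>))"

lemma twisted_conv_eq:
  assumes "finite S" and "{\<alpha>. f \<alpha> \<noteq> 0 \<and> g (\<gamma> - \<alpha>) \<noteq> 0} \<subseteq> S"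
  shows "twisted_conv f g \<gamma> = (\<Sum>\<alpha>\<in>S. \<nu>\<^bsup>Lam \<alpha> (\<gamma> - \<alpha>)\<^esup> * f \<alpha> * g (\<gamma> - \<alpha>))"
  unfolding twisted_conv_def by (rule sum.mono_neutral_left) (use assms in auto)

definition supp_le :: "(int \<times> int \<Rightarrow> laurent) \<Rightarrow> int \<Rightarrow> bool"
  where "supp_le f M \<longleftrightarrow> (\<forall>\<alpha>. f \<alpha> \<noteq> 0 \<longrightarrow> fst \<alpha> \<le> M \<and> snd \<alpha> \<le> M)"

lemma supp_leD: "supp_le f M \<Longrightarrow> f \<alpha> \<noteq> 0 \<Longrightarrow> fst \<alpha> \<le> M \<and> snd \<alpha> \<le> M"
  unfolding supp_le_def by blast

lemma supp_leI: "(\<And>\<alpha>. f \<alpha> \<noteq> 0 \<Longrightarrow> fst \<alpha> \<le> M \<and> snd \<alpha> \<le> M) \<Longrightarrow> supp_le f M"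
  unfolding supp_le_def by blast

lemma supp_le_mono: "supp_le f M \<Longrightarrow> M \<le> N \<Longrightarrow> supp_le f N"
  unfolding supp_le_def by force

lemma bdd_suppI: "supp_le f M \<Longrightarrow> bdd_supp f"
  unfolding bdd_supp_def supp_le_def by blast

lemma bdd_suppE:
  assumes "bdd_supp f"
  obtains M where "supp_le f M"
proof -
  from assms obtain M N where "\<forall>\<alpha>. f \<alpha> \<noteq> 0 \<longrightarrow> fst \<alpha> \<le> M \<and> snd \<alpha> \<le> N"
    unfolding bdd_supp_def by blast
  then show thesis by (intro that[of "max M N"]) (force simp: supp_le_def)
qed

lemma bdd_supp3E:
  assumes "bdd_supp f" and "bdd_supp g" and "bdd_supp h"
  obtains M where "0 \<le> M" and "supp_le f M" and "supp_le g M" and "supp_le h M"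
proof -
  obtain M1 M2 M3 where "supp_le f M1" "supp_le g M2" "supp_le h M3"
    using assms bdd_suppE by metis
  then show thesis
    by (intro that[of "max 0 (max M1 (max M2 M3))"]) (auto elim: supp_le_mono)
qed

definition lattice_box :: "int \<times> int \<Rightarrow> int \<Rightarrow> (int \<times> int) set"
  where "lattice_box \<gamma> M = {fst \<gamma> - M..M} \<times> {snd \<gamma> - M..M}"

lemma finite_lattice_box [simp]: "finite (lattice_box \<gamma> M)"
  by (simp add: lattice_box_def)

lemma mem_lattice_box:
  "\<alpha> \<in> lattice_box \<gamma> M \<longleftrightarrow>
    fst \<gamma> - M \<le> fst \<alpha> \<and> fst \<alpha> \<le> M \<and> snd \<gamma> - M \<le> snd \<alpha> \<and> snd \<alpha> \<le> M"
  by (cases \<alpha>) (auto simp: lattice_box_def)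

lemma twisted_conv_box:
  assumes "supp_le f M" and "supp_le g M"
  shows "twisted_conv f g \<gamma> =
    (\<Sum>\<alpha>\<in>lattice_box \<gamma> M. \<nu>\<^bsup>Lam \<alpha> (\<gamma> - \<alpha>)\<^esup> * f \<alpha> * g (\<gamma> - \<alpha>))"
proof (rule twisted_conv_eq)
  show "{\<alpha>. f \<alpha> \<noteq> 0 \<and> g (\<gamma> - \<alpha>) \<noteq> 0} \<subseteq> lattice_box \<gamma> M"
  proof
    fix \<alpha> assume "\<alpha> \<in> {\<alpha>. f \<alpha> \<noteq> 0 \<and> g (\<gamma> - \<alpha>) \<noteq> 0}"
    then show "\<alpha> \<in> lattice_box \<gamma> M"
      using supp_leD[OF assms(1), of \<alpha>] supp_leD[OF assms(2), of "\<gamma> - \<alpha>"] by (simp add: mem_lattice_box)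
  qed
qed simp

lemma twisted_conv_supp:
  assumes "supp_le f M" and "supp_le g N"
  shows "supp_le (twisted_conv f g) (M + N)"
proof (rule supp_leI)
  fix \<gamma> assume "twisted_conv f g \<gamma> \<noteq> 0"
  then have "{\<alpha>. f \<alpha> \<noteq> 0 \<and> g (\<gamma> - \<alpha>) \<noteq> 0} \<noteq> {}"
    unfolding twisted_conv_def by (rule contrapos_nn) (simp only: sum.empty)
  then obtain \<alpha> where "f \<alpha> \<noteq> 0" "g (\<gamma> - \<alpha>) \<noteq> 0"
    by blast
  then show "fst \<gamma> \<le> M + N \<and> snd \<gamma> \<le> M + N"
    using supp_leD[OF assms(1), of \<alpha>] supp_leD[OF assms(2), of "\<gamma> - \<alpha>"] by auto
qed

lemma bdd_supp_twisted_conv: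
  assumes "bdd_supp f" and "bdd_supp g"
  shows "bdd_supp (twisted_conv f g)"
  by (metis assms bdd_suppE bdd_suppI twisted_conv_supp)

lemma supp_le_add: "supp_le f M \<Longrightarrow> supp_le g M \<Longrightarrow> supp_le (\<lambda>\<alpha>. f \<alpha> + g \<alpha>) M"
  unfolding supp_le_def by (metis add.right_neutral)

lemma bdd_supp_add:
  assumes "bdd_supp f" and "bdd_supp g"
  shows "bdd_supp (\<lambda>\<alpha>. f \<alpha> + g \<alpha>)"
  using bdd_supp3E[OF assms assms(1)] bdd_suppI[OF supp_le_add] by metis

lemma bdd_supp_mono: "bdd_supp f \<Longrightarrow> (\<And>\<alpha>. f \<alpha> = 0 \<Longrightarrow> g \<alpha> = 0) \<Longrightarrow> bdd_supp g"
  unfolding bdd_supp_def by metis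

lemma twisted_conv_assoc:
  assumes "bdd_supp f" and "bdd_supp g" and "bdd_supp h"
  shows "twisted_conv (twisted_conv f g) h = twisted_conv f (twisted_conv g h)"
proof
  fix \<delta>
  obtain M where M: "0 \<le> M" and f: "supp_le f M" and g: "supp_le g M" and h: "supp_le h M"
    using bdd_supp3E[OF assms] by blast
  define T where "T = lattice_box \<delta> (2 * M)"
  have fT: "finite T" by (simp add: T_def)
  have *: "twisted_conv f g \<beta> * h (\<delta> - \<beta>) =
      (\<Sum>\<alpha>\<in>T. \<nu>\<^bsup>Lam \<alpha> (\<beta> - \<alpha>)\<^esup> * f \<alpha> * g (\<beta> - \<alpha>)) * h (\<delta> - \<beta>)" for \<beta>
  proof (cases "h (\<delta> - \<beta>) = 0")
    case False
    have "{\<alpha>. f \<alpha> \<noteq> 0 \<and> g (\<beta> - \<alpha>) \<noteq> 0} \<subseteq> T"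
    proof
      fix \<alpha> assume "\<alpha> \<in> {\<alpha>. f \<alpha> \<noteq> 0 \<and> g (\<beta> - \<alpha>) \<noteq> 0}"
      then show "\<alpha> \<in> T"
        using supp_leD[OF f, of \<alpha>] supp_leD[OF g, of "\<beta> - \<alpha>"] supp_leD[OF h False] M by (simp add: T_def mem_lattice_box)
    qed
    then show ?thesis by (simp add: twisted_conv_eq[OF fT])
  qed simp
  have **: "f \<alpha> * twisted_conv g h (\<delta> - \<alpha>) =
      f \<alpha> * (\<Sum>\<beta>\<in>T. \<nu>\<^bsup>Lam (\<beta> - \<alpha>) (\<delta> - \<beta>)\<^esup> * g (\<beta> - \<alpha>) * h (\<delta> - \<beta>))" for \<alpha>
  proof (cases "f \<alpha> = 0")
    case False
    have "{\<beta>. g \<beta> \<noteq> 0 \<and> h (\<delta> - \<alpha> - \<beta>) \<noteq> 0} \<subseteq> (\<lambda>\<beta>. \<beta> - \<alpha>) ` T"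
    proof
      fix \<beta> assume "\<beta> \<in> {\<beta>. g \<beta> \<noteq> 0 \<and> h (\<delta> - \<alpha> - \<beta>) \<noteq> 0}"
      then have "\<beta> + \<alpha> \<in> T"
        using supp_leD[OF g, of \<beta>] supp_leD[OF h, of "\<delta> - \<alpha> - \<beta>"] supp_leD[OF f False] M by (auto simp: T_def mem_lattice_box)
      then show "\<beta> \<in> (\<lambda>\<beta>. \<beta> - \<alpha>) ` T" by (force intro: image_eqI[of _ _ "\<beta> + \<alpha>"])
    qed
    then have "twisted_conv g h (\<delta> - \<alpha>) = (\<Sum>\<beta>\<in>(\<lambda>\<beta>. \<beta> - \<alpha>) ` T.
        \<nu>\<^bsup>Lam \<beta> (\<delta> - \<alpha> - \<beta>)\<^esup> * g \<beta> * h (\<delta> - \<alpha> - \<beta>))"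
      by (intro twisted_conv_eq) (simp_all add: fT)
    also have "\<dots> = (\<Sum>\<beta>\<in>T. \<nu>\<^bsup>Lam (\<beta> - \<alpha>) (\<delta> - \<beta>)\<^esup> * g (\<beta> - \<alpha>) * h (\<delta> - \<beta>))"
      by (subst sum.reindex) (auto simp: inj_on_def algebra_simps)
    finally show ?thesis by simp
  qed simp
  have fg: "supp_le (twisted_conv f g) (2 * M)" and gh: "supp_le (twisted_conv g h) (2 * M)"
    using twisted_conv_supp[OF f g] twisted_conv_supp[OF g h] by simp_all
  have f2: "supp_le f (2 * M)" and h2: "supp_le h (2 * M)"
    using M supp_le_mono[OF f] supp_le_mono[OF h] by simp_all
  have "twisted_conv (twisted_conv f g) h \<delta> =
      (\<Sum>\<beta>\<in>T. \<nu>\<^bsup>Lam \<beta> (\<delta> - \<beta>)\<^esup> * (twisted_conv f g \<beta> * h (\<delta> - \<beta>)))"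
    using twisted_conv_box[OF fg h2] by (simp add: T_def mult.assoc)
  also have "\<dots> = (\<Sum>\<beta>\<in>T. \<Sum>\<alpha>\<in>T. (\<nu>\<^bsup>Lam \<beta> (\<delta> - \<beta>)\<^esup> * \<nu>\<^bsup>Lam \<alpha> (\<beta> - \<alpha>)\<^esup>) *
      (f \<alpha> * g (\<beta> - \<alpha>) * h (\<delta> - \<beta>)))"
    unfolding * by (simp add: sum_distrib_left sum_distrib_right mult_ac)
  also have "\<dots> = (\<Sum>\<beta>\<in>T. \<Sum>\<alpha>\<in>T. (\<nu>\<^bsup>Lam \<alpha> (\<delta> - \<alpha>)\<^esup> * \<nu>\<^bsup>Lam (\<beta> - \<alpha>) (\<delta> - \<beta>)\<^esup>) *
      (f \<alpha> * g (\<beta> - \<alpha>) * h (\<delta> - \<beta>)))"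
  proof -
    have "Lam \<beta> (\<delta> - \<beta>) + Lam \<alpha> (\<beta> - \<alpha>) = Lam \<alpha> (\<delta> - \<alpha>) + Lam (\<beta> - \<alpha>) (\<delta> - \<beta>)" for \<alpha> \<beta>
      by (simp add: Lam_def algebra_simps)
    then show ?thesis by (simp add: nu_pow_mult)
  qed
  also have "\<dots> = (\<Sum>\<alpha>\<in>T. \<nu>\<^bsup>Lam \<alpha> (\<delta> - \<alpha>)\<^esup> * (f \<alpha> * twisted_conv g h (\<delta> - \<alpha>)))"
    unfolding ** by (subst sum.swap) (simp add: sum_distrib_left mult_ac)
  also have "\<dots> = twisted_conv f (twisted_conv g h) \<delta>"
    using twisted_conv_box[OF f2 gh] by (simp add: T_def mult.assoc)
  finally show "twisted_conv (twisted_conv f g) h \<delta> = twisted_conv f (twisted_conv g h) \<delta>" .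
qed

lemma twisted_conv_add_left:
  assumes "bdd_supp f" and "bdd_supp g" and "bdd_supp h"
  shows "twisted_conv (\<lambda>\<alpha>. f \<alpha> + g \<alpha>) h \<gamma> = twisted_conv f h \<gamma> + twisted_conv g h \<gamma>"
proof -
  obtain M where f: "supp_le f M" and g: "supp_le g M" and h: "supp_le h M"
    using bdd_supp3E[OF assms] by blast
  note fg = supp_le_add[OF f g]
  show ?thesis
    by (simp only: twisted_conv_box[OF f h] twisted_conv_box[OF g h] twisted_conv_box[OF fg h]
        sum.distrib[symmetric] distrib_left distrib_right)
qed

lemma twisted_conv_add_right:
  assumes "bdd_supp f" and "bdd_supp g" and "bdd_supp h"
  shows "twisted_conv h (\<lambda>\<alpha>. f \<alpha> + g \<alpha>) \<gamma> = twisted_conv h f \<gamma> + twisted_conv h g \<gamma>"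
proof -
  obtain M where f: "supp_le f M" and g: "supp_le g M" and h: "supp_le h M"
    using bdd_supp3E[OF assms] by blast
  note fg = supp_le_add[OF f g]
  show ?thesis
    by (simp only: twisted_conv_box[OF h f] twisted_conv_box[OF h g] twisted_conv_box[OF h fg]
        sum.distrib[symmetric] distrib_left distrib_right)
qed

lemma twisted_conv_scale_left:
  "twisted_conv (\<lambda>\<alpha>. c * f \<alpha>) g \<gamma> = c * twisted_conv f g \<gamma>"
  by (cases "c = 0") (simp_all add: twisted_conv_def sum_distrib_left mult_ac)

lemma twisted_conv_scale_right:
  "twisted_conv f (\<lambda>\<alpha>. c * g \<alpha>) \<gamma> = c * twisted_conv f g \<gamma>"
  by (cases "c = 0") (simp_all add: twisted_conv_def sum_distrib_left mult_ac)

text \<open>A formal sum \<open>\<Sum> c\<^sub>\<alpha> X\<^sup>\<alpha>\<close> is represented by its coefficient function \<open>\<alpha> \<mapsto> c\<^sub>\<alpha>\<close>.\<close>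

typedef qtorus = "{f :: int \<times> int \<Rightarrow> laurent. bdd_supp f}"
  morphisms qcoeff Abs_qtorus
  by (rule exI[of _ "\<lambda>_. 0"]) (simp add: bdd_supp_def)

lifting_forget poly_mapping.lifting
setup_lifting type_definition_qtorus

instantiation qtorus :: ring_1
begin

lift_definition zero_qtorus :: qtorus is "\<lambda>_. 0"
  by (simp add: bdd_supp_def)

lift_definition one_qtorus :: qtorus is "\<lambda>\<alpha>. if \<alpha> = 0 then 1 else 0"
  by (rule bdd_suppI[of _ 0]) (auto simp: supp_le_def zero_prod_def)

lift_definition plus_qtorus :: "qtorus \<Rightarrow> qtorus \<Rightarrow> qtorus" is "\<lambda>f g \<alpha>. f \<alpha> + g \<alpha>"
  by (rule bdd_supp_add)

lift_definition uminus_qtorus :: "qtorus \<Rightarrow> qtorus" is "\<lambda>f \<alpha>. - f \<alpha>"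
  by (erule bdd_supp_mono) simp

lift_definition minus_qtorus :: "qtorus \<Rightarrow> qtorus \<Rightarrow> qtorus" is "\<lambda>f g \<alpha>. f \<alpha> - g \<alpha>"
proof -
  fix f g :: "int \<times> int \<Rightarrow> laurent" assume "bdd_supp f" "bdd_supp g"
  then have "bdd_supp (\<lambda>\<alpha>. f \<alpha> + (- g \<alpha>))"
    by (intro bdd_supp_add) (auto elim: bdd_supp_mono)
  then show "bdd_supp (\<lambda>\<alpha>. f \<alpha> - g \<alpha>)" by simp
qed

lift_definition times_qtorus :: "qtorus \<Rightarrow> qtorus \<Rightarrow> qtorus" is twisted_conv
  by (rule bdd_supp_twisted_conv)

instance
proof
  fix a b c :: qtorus
  show "a * b * c = a * (b * c)" by transfer (rule twisted_conv_assoc)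
  show "(a + b) * c = a * c + b * c" by transfer (rule ext, rule twisted_conv_add_left)
  show "a * (b + c) = a * b + a * c" by transfer (rule ext, rule twisted_conv_add_right)
  show "1 * a = a"
  proof (transfer, rule ext)
    fix f :: "int \<times> int \<Rightarrow> laurent" and \<gamma>
    show "twisted_conv (\<lambda>\<alpha>. if \<alpha> = 0 then 1 else 0) f \<gamma> = f \<gamma>"
      by (subst twisted_conv_eq[of "{0}"]) (auto split: if_splits)
  qed
  show "a * 1 = a"
  proof (transfer, rule ext)
    fix f :: "int \<times> int \<Rightarrow> laurent" and \<gamma>
    show "twisted_conv f (\<lambda>\<alpha>. if \<alpha> = 0 then 1 else 0) \<gamma> = f \<gamma>"
      by (subst twisted_conv_eq[of "{\<gamma>}"]) (auto split: if_splits)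
  qed
  show "(0::qtorus) \<noteq> 1" by transfer (metis zero_neq_one)
qed (transfer; simp add: fun_eq_iff algebra_simps)+

end

lift_definition qscale :: "laurent \<Rightarrow> qtorus \<Rightarrow> qtorus"  (infixr \<open>*\<^sub>\<nu>\<close> 75)
  is "\<lambda>c f \<alpha>. c * f \<alpha>"
  by (erule bdd_supp_mono) simp

lemma qscale_mult_left: "(c *\<^sub>\<nu> a) * b = c *\<^sub>\<nu> (a * b)"
  by transfer (rule ext, rule twisted_conv_scale_left)

lemma qscale_mult_right: "a * (c *\<^sub>\<nu> b) = c *\<^sub>\<nu> (a * b)"
  by transfer (rule ext, rule twisted_conv_scale_right)

global_interpretation qtorus: module qscale
  defines qtorus_subspace = qtorus.subspace
  by standard (transfer; simp add: fun_eq_iff algebra_simps)+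

lift_definition qmono :: "int \<times> int \<Rightarrow> qtorus"  (\<open>X\<^bsup>_\<^esup>\<close>)
  is "\<lambda>\<alpha> \<beta>. if \<beta> = \<alpha> then 1 else 0"
  subgoal for \<alpha>
    by (rule bdd_suppI[of _ "max (fst \<alpha>) (snd \<alpha>)"]) (auto simp: supp_le_def)
  done

lemma qmono_mult: "X\<^bsup>\<alpha>\<^esup> * X\<^bsup>\<beta>\<^esup> = \<nu>\<^bsup>Lam \<alpha> \<beta>\<^esup> *\<^sub>\<nu> X\<^bsup>\<alpha> + \<beta>\<^esup>"
proof (transfer, rule ext)
  fix \<alpha> \<beta> \<gamma> :: "int \<times> int"
  show "twisted_conv (\<lambda>x. if x = \<alpha> then 1 else 0) (\<lambda>x. if x = \<beta> then 1 else 0) \<gamma> =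
      \<nu>\<^bsup>Lam \<alpha> \<beta>\<^esup> * (if \<gamma> = \<alpha> + \<beta> then 1 else 0)"
    by (subst twisted_conv_eq[of "{\<alpha>}"]) (auto split: if_splits simp: algebra_simps)
qed

text \<open>The quantum torus itself: the finite formal sums inside its completion.\<close>

definition quantum_torus :: "qtorus set"
  where "quantum_torus = {a. finite {\<alpha>. qcoeff a \<alpha> \<noteq> 0}}"

section \<open>Subalgebras and isomorphisms\<close>

definition subalgebra :: "qtorus set \<Rightarrow> bool"
  where "subalgebra A \<longleftrightarrow> qtorus.subspace A \<and> 1 \<in> A \<and> (\<forall>a\<in>A. \<forall>b\<in>A. a * b \<in> A)"

definition algebra_iso :: "(qtorus \<Rightarrow> qtorus) \<Rightarrow> qtorus set \<Rightarrow> qtorus set \<Rightarrow> bool"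
  where "algebra_iso \<kappa> A B \<longleftrightarrow>
    bij_betw \<kappa> A B \<and> \<kappa> 1 = 1 \<and>
    (\<forall>a\<in>A. \<forall>b\<in>A. \<kappa> (a + b) = \<kappa> a + \<kappa> b \<and> \<kappa> (a * b) = \<kappa> a * \<kappa> b) \<and>
    (\<forall>c. \<forall>a\<in>A. \<kappa> (c *\<^sub>\<nu> a) = c *\<^sub>\<nu> \<kappa> a)"

section \<open>The quantum cluster algebra of the Kronecker quiver\<close>

definition kronecker_family :: "(int \<Rightarrow> qtorus) \<Rightarrow> bool"
  where "kronecker_family X \<longleftrightarrow>
    (\<forall>l. X l \<in> quantum_torus) \<and> X 1 = X\<^bsup>(0, 1)\<^esup> \<and> X 2 = X\<^bsup>(1, 0)\<^esup> \<and>
    (\<forall>l. X (l - 2) * X l = \<nu>\<^bsup>2\<^esup> *\<^sub>\<nu> (X (l - 1))\<^sup>2 + 1)"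

text \<open>The exchange relations determine the family: it exists by the quantum Laurent phenomenon
  and is unique because the quantum torus has no zero divisors.\<close>

definition X_V :: "int \<Rightarrow> qtorus"
  where "X_V = (THE X. kronecker_family X)"

text \<open>The generators lie in \<^const>\<open>quantum_torus\<close>, which is itself a subalgebra, so generating inside
  the completion gives the same algebra.\<close>

definition A22 :: "qtorus set"
  where "A22 = subalgebra hull (range X_V)"

section \<open>The quantum cluster algebra of the projective line\<close>

text \<open>At each exponent at most one index \<open>r\<close> contributes to the sum.\<close>

lift_definition X_O :: "int \<Rightarrow> qtorus" is
  "\<lambda>l \<alpha>. (if \<alpha> = - (l + 1, - 1) then 1 else 0) +
    (\<Sum>r | r \<ge> - l \<and> \<alpha> = - (l + 2 * r + 1, 1).
      \<nu>\<^bsup>- 2 * (l + r)\<^esup> * exact_quotient (\<nu>\<^bsup>4 * (l + r + 1)\<^esup> - 1) (\<nu>\<^bsup>4\<^esup> - 1))"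
proof (rule bdd_supp_add)
  fix l :: int
  show "bdd_supp (\<lambda>\<alpha>. if \<alpha> = - (l + 1, - 1) then 1 else 0)"
    by (rule bdd_suppI[of _ "max (- l - 1) 1"]) (auto simp: supp_le_def)
  show "bdd_supp (\<lambda>\<alpha>. \<Sum>r | r \<ge> - l \<and> \<alpha> = - (l + 2 * r + 1, 1).
      \<nu>\<^bsup>- 2 * (l + r)\<^esup> * exact_quotient (\<nu>\<^bsup>4 * (l + r + 1)\<^esup> - 1) (\<nu>\<^bsup>4\<^esup> - 1))"
  proof (rule bdd_suppI[of _ "max (l - 1) (- 1)"], rule supp_leI)
    fix \<alpha> :: "int \<times> int"
    assume "(\<Sum>r | r \<ge> - l \<and> \<alpha> = - (l + 2 * r + 1, 1).
      \<nu>\<^bsup>- 2 * (l + r)\<^esup> * exact_quotient (\<nu>\<^bsup>4 * (l + r + 1)\<^esup> - 1) (\<nu>\<^bsup>4\<^esup> - 1)) \<noteq> 0"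
    then have "{r. r \<ge> - l \<and> \<alpha> = - (l + 2 * r + 1, 1)} \<noteq> {}"
      by (rule contrapos_nn) (simp only: sum.empty)
    then obtain r where "r \<ge> - l" "\<alpha> = - (l + 2 * r + 1, 1)"
      by blast
    then show "fst \<alpha> \<le> max (l - 1) (- 1) \<and> snd \<alpha> \<le> max (l - 1) (- 1)" by auto
  qed
qed

definition A_P1 :: "qtorus set"
  where "A_P1 = subalgebra hull (range X_O)"

end

theory Submission
  imports Defs
begin

text \<open>
  Write \<open>Y\<^sub>l\<close> for \<open>X_O (- l)\<close>, a monomial \<open>P\<^sub>l = X\<^bsup>(l - 1, 1)\<^esup>\<close> plus an infinite tail \<open>Q\<^sub>l\<close>. Multiplication by
  \<open>X\<^bsup>(1, 0)\<^esup>\<close> shifts the index of \<open>P\<^sub>l\<close> and \<open>Q\<^sub>l\<close> in opposite directions, up to powers of \<open>\<nu>\<close>; so \<open>Y\<close>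
  satisfies a linear recurrence with \<open>z = X\<^bsup>(1, 0)\<^esup> + X\<^bsup>(- 1, 0)\<^esup>\<close>, and in the exchange relation the terms
  \<open>PP\<close> and \<open>QQ\<close> cancel, leaving a comparison of coefficients in the mixed terms. Since \<open>Y\<^sub>1\<close> and \<open>Y\<^sub>2\<close> are
  units of the completion (Neumann series) and \<open>Y\<^sub>1 Y\<^sub>2 = \<nu>\<^sup>2 Y\<^sub>2 Y\<^sub>1\<close>, the assignment \<open>x\<^sub>2 \<mapsto> Y\<^sub>1\<close>,
  \<open>x\<^sub>1 \<mapsto> Y\<^sub>2\<close> extends to a homomorphism \<open>\<phi>\<close> on the quantum torus, injective by comparison of
  lexicographically leading terms. The recurrence places every \<open>Y\<^sub>l\<close> in the image of \<open>\<phi>\<close>, so the elements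
  \<open>\<phi>\<^sup>-\<^sup>1 Y\<^sub>l\<close> form a Kronecker family. As the completion has no zero divisors it is the only one,
  and the restriction of \<open>\<phi>\<close> is the isomorphism.
\<close>

section \<open>Coefficients\<close>

lemma qtorus_eqI: "(\<And>\<alpha>. qcoeff a \<alpha> = qcoeff b \<alpha>) \<Longrightarrow> a = b"
  by (simp add: qcoeff_inject[symmetric] fun_eq_iff)

lemma qcoeff_simps [simp]:
  "qcoeff 0 \<alpha> = 0"
  "qcoeff (a + b) \<alpha> = qcoeff a \<alpha> + qcoeff b \<alpha>"
  "qcoeff (a - b) \<alpha> = qcoeff a \<alpha> - qcoeff b \<alpha>"
  "qcoeff (- a) \<alpha> = - qcoeff a \<alpha>"
  "qcoeff (c *\<^sub>\<nu> a) \<alpha> = c * qcoeff a \<alpha>"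
  by (transfer, simp)+

lemma qcoeff_1: "qcoeff 1 \<alpha> = (if \<alpha> = 0 then 1 else 0)"
  by transfer simp

lemma qcoeff_qmono: "qcoeff X\<^bsup>\<alpha>\<^esup> \<beta> = (if \<beta> = \<alpha> then 1 else 0)"
  by transfer simp

lemma qcoeff_sum: "qcoeff (sum f S) \<alpha> = (\<Sum>i\<in>S. qcoeff (f i) \<alpha>)"
  by (induction S rule: infinite_finite_induct) simp_all

lemma qcoeff_mult: "qcoeff (a * b) = twisted_conv (qcoeff a) (qcoeff b)"
  by transfer simp

lemma qcoeff_qmono_mult:
  "qcoeff (X\<^bsup>\<alpha>\<^esup> * a) \<gamma> = \<nu>\<^bsup>Lam \<alpha> (\<gamma> - \<alpha>)\<^esup> * qcoeff a (\<gamma> - \<alpha>)"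
  unfolding qcoeff_mult
  by (subst twisted_conv_eq[of "{\<alpha>}"]) (auto simp: qcoeff_qmono split: if_splits)

lemma qcoeff_mult_qmono:
  "qcoeff (a * X\<^bsup>\<alpha>\<^esup>) \<gamma> = \<nu>\<^bsup>Lam (\<gamma> - \<alpha>) \<alpha>\<^esup> * qcoeff a (\<gamma> - \<alpha>)"
  unfolding qcoeff_mult
  by (subst twisted_conv_eq[of "{\<gamma> - \<alpha>}"])
    (auto simp: qcoeff_qmono algebra_simps split: if_splits)

lemma qcoeff_mult_nonzeroE:
  assumes "qcoeff (a * b) \<gamma> \<noteq> 0"
  obtains \<alpha> where "qcoeff a \<alpha> \<noteq> 0" and "qcoeff b (\<gamma> - \<alpha>) \<noteq> 0"
proof -
  have "{\<alpha>. qcoeff a \<alpha> \<noteq> 0 \<and> qcoeff b (\<gamma> - \<alpha>) \<noteq> 0} \<noteq> {}"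
    using assms unfolding qcoeff_mult twisted_conv_def
    by (rule contrapos_nn) (simp only: sum.empty)
  then show thesis using that by blast
qed

lemma qmono_0 [simp]: "X\<^bsup>0\<^esup> = 1"
  by (rule qtorus_eqI) (simp add: qcoeff_1 qcoeff_qmono)

lemma qscale_simps [simp]:
  "c *\<^sub>\<nu> d *\<^sub>\<nu> a = (c * d) *\<^sub>\<nu> a" "1 *\<^sub>\<nu> a = a"
  by (simp_all add: qtorus.scale_scale)

lemma nu_pow_mult_left: "\<nu>\<^bsup>j\<^esup> * (\<nu>\<^bsup>k\<^esup> * c) = \<nu>\<^bsup>j + k\<^esup> * c"
  by (simp add: nu_pow_mult mult.assoc[symmetric])

lemma nu_pow_nonzero: "\<nu>\<^bsup>k\<^esup> \<noteq> 0"
  by (metis mult_zero_left nu_pow_0 nu_pow_mult add.right_inverse zero_neq_one)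

lemmas qscale_push = qscale_mult_left qscale_mult_right qtorus.scale_right_distrib
  qtorus.scale_right_diff_distrib nu_pow_mult nu_pow_mult_left distrib_left distrib_right

section \<open>Leading terms\<close>

definition lex_le :: "int \<times> int \<Rightarrow> int \<times> int \<Rightarrow> bool"
  where "lex_le \<alpha> \<beta> \<longleftrightarrow> fst \<alpha> < fst \<beta> \<or> fst \<alpha> = fst \<beta> \<and> snd \<alpha> \<le> snd \<beta>"

definition leading :: "qtorus \<Rightarrow> int \<times> int \<Rightarrow> bool"
  where "leading a \<alpha> \<longleftrightarrow> qcoeff a \<alpha> \<noteq> 0 \<and> (\<forall>\<beta>. qcoeff a \<beta> \<noteq> 0 \<longrightarrow> lex_le \<beta> \<alpha>)"

lemma leading_unique: "leading a \<alpha> \<Longrightarrow> leading a \<beta> \<Longrightarrow> \<alpha> = \<beta>"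
  unfolding leading_def lex_le_def by (metis less_asym order_antisym prod_eq_iff)

lemma leading_nonzero: "leading a \<alpha> \<Longrightarrow> a \<noteq> 0"
  by (auto simp: leading_def)

lemma int_set_has_max:
  fixes S :: "int set"
  assumes "x \<in> S" and "\<And>y. y \<in> S \<Longrightarrow> y \<le> M"
  obtains m where "m \<in> S" and "\<And>y. y \<in> S \<Longrightarrow> y \<le> m"
proof -
  have fin: "finite (S \<inter> {x..})"
    by (rule finite_subset[of _ "{x..M}"]) (use assms in auto)
  have "S \<inter> {x..} \<noteq> {}" using assms by auto
  then have "Max (S \<inter> {x..}) \<in> S \<inter> {x..}" by (rule Max_in[OF fin])
  moreover have "y \<le> Max (S \<inter> {x..})" if "y \<in> S" for y
    using that Max_ge[OF fin, of y] calculation by fastforce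
  ultimately show thesis using that by blast
qed

text \<open>Supports may be infinite but are bounded above, so the largest first coordinate is
  attained, and then the largest second coordinate in that column.\<close>

lemma leading_exists:
  assumes "a \<noteq> 0"
  obtains \<alpha> where "leading a \<alpha>"
proof -
  obtain M where M: "supp_le (qcoeff a) M"
    using qcoeff bdd_suppE by blast
  obtain \<beta> where \<beta>: "qcoeff a \<beta> \<noteq> 0"
    using assms qtorus_eqI[of a 0] by auto
  obtain m where m: "m \<in> {fst \<alpha> |\<alpha>. qcoeff a \<alpha> \<noteq> 0}"
      "\<And>y. y \<in> {fst \<alpha> |\<alpha>. qcoeff a \<alpha> \<noteq> 0} \<Longrightarrow> y \<le> m"
    by (rule int_set_has_max[of "fst \<beta>" "{fst \<alpha> |\<alpha>. qcoeff a \<alpha> \<noteq> 0}" M])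
      (use \<beta> supp_leD[OF M] in \<open>auto intro: exI[of _ "snd \<beta>"]\<close>)
  then obtain k0 where "qcoeff a (m, k0) \<noteq> 0" by auto
  then obtain k where k: "k \<in> {k. qcoeff a (m, k) \<noteq> 0}"
      "\<And>y. y \<in> {k. qcoeff a (m, k) \<noteq> 0} \<Longrightarrow> y \<le> k"
    by (rule_tac int_set_has_max[of k0 "{k. qcoeff a (m, k) \<noteq> 0}" M])
      (use supp_leD[OF M] in auto)
  have "leading a (m, k)"
    unfolding leading_def lex_le_def using k m(2) by force
  then show thesis by (rule that)
qed

text \<open>Only the pair (\<alpha>, \<beta>) contributes to the coefficient at \<alpha> + \<beta>,
  and Laurent polynomials have no zero divisors.\<close>

lemma leading_mult:
  assumes "leading a \<alpha>" and "leading b \<beta>"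
  shows "leading (a * b) (\<alpha> + \<beta>)"
proof -
  have a: "qcoeff a \<alpha> \<noteq> 0" "\<And>\<gamma>. qcoeff a \<gamma> \<noteq> 0 \<Longrightarrow> lex_le \<gamma> \<alpha>"
    and b: "qcoeff b \<beta> \<noteq> 0" "\<And>\<gamma>. qcoeff b \<gamma> \<noteq> 0 \<Longrightarrow> lex_le \<gamma> \<beta>"
    using assms by (auto simp: leading_def)
  have "{\<delta>. qcoeff a \<delta> \<noteq> 0 \<and> qcoeff b (\<alpha> + \<beta> - \<delta>) \<noteq> 0} \<subseteq> {\<alpha>}"
  proof
    fix \<delta> assume "\<delta> \<in> {\<delta>. qcoeff a \<delta> \<noteq> 0 \<and> qcoeff b (\<alpha> + \<beta> - \<delta>) \<noteq> 0}"
    then have "lex_le \<delta> \<alpha>" "lex_le (\<alpha> + \<beta> - \<delta>) \<beta>" using a b by auto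
    then show "\<delta> \<in> {\<alpha>}" by (auto simp: lex_le_def prod_eq_iff)
  qed
  then have "qcoeff (a * b) (\<alpha> + \<beta>) = \<nu>\<^bsup>Lam \<alpha> \<beta>\<^esup> * qcoeff a \<alpha> * qcoeff b \<beta>"
    unfolding qcoeff_mult by (subst twisted_conv_eq[of "{\<alpha>}"]) simp_all
  moreover have "lex_le \<gamma> (\<alpha> + \<beta>)" if *: "qcoeff (a * b) \<gamma> \<noteq> 0" for \<gamma>
  proof -
    obtain \<delta> where "qcoeff a \<delta> \<noteq> 0" "qcoeff b (\<gamma> - \<delta>) \<noteq> 0"
      using * by (rule qcoeff_mult_nonzeroE)
    then have "lex_le \<delta> \<alpha>" "lex_le (\<gamma> - \<delta>) \<beta>" using a b by auto
    then show ?thesis by (auto simp: lex_le_def)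
  qed
  ultimately show ?thesis using a b by (simp add: leading_def nu_pow_nonzero)
qed

lemma qtorus_no_zero_divisors:
  fixes a b :: qtorus
  assumes "a \<noteq> 0" and "b \<noteq> 0"
  shows "a * b \<noteq> 0"
  by (metis assms leading_exists leading_mult leading_nonzero)

lemma qtorus_cancel_left: "(a::qtorus) \<noteq> 0 \<Longrightarrow> a * b = a * c \<Longrightarrow> b = c"
  using qtorus_no_zero_divisors[of a "b - c"] by (auto simp: algebra_simps)

lemma qtorus_cancel_right: "(a::qtorus) \<noteq> 0 \<Longrightarrow> b * a = c * a \<Longrightarrow> b = c"
  using qtorus_no_zero_divisors[of "b - c" a] by (auto simp: algebra_simps)

lemma leading_1: "leading 1 0"
  by (auto simp: leading_def qcoeff_1 lex_le_def zero_prod_def split: if_splits)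

lemma leading_inverse:
  assumes "leading a \<alpha>" and "a * b = 1"
  shows "leading b (- \<alpha>)"
proof -
  have "b \<noteq> 0" using assms(2) by auto
  then obtain \<beta> where \<beta>: "leading b \<beta>" by (rule leading_exists)
  then have "\<alpha> + \<beta> = 0"
    using leading_mult[OF assms(1) \<beta>] assms(2) leading_1 leading_unique by metis
  then show ?thesis using \<beta> by (metis minus_unique)
qed

section \<open>Units of the completion\<close>

text \<open>A filtration by the first coordinate; the fixed bound on the second keeps infinite sums
  of powers inside the completion.\<close>

definition fst_below :: "int \<Rightarrow> qtorus \<Rightarrow> bool"
  where "fst_below k a \<longleftrightarrow> (\<forall>\<alpha>. qcoeff a \<alpha> \<noteq> 0 \<longrightarrow> fst \<alpha> \<le> k \<and> snd \<alpha> \<le> 0)"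

lemma fst_belowD: "fst_below k a \<Longrightarrow> k < fst \<alpha> \<or> 0 < snd \<alpha> \<Longrightarrow> qcoeff a \<alpha> = 0"
  unfolding fst_below_def by (meson leD)

lemma fst_below_mult:
  assumes "fst_below k a" and "fst_below l b"
  shows "fst_below (k + l) (a * b)"
  unfolding fst_below_def
proof (intro allI impI)
  fix \<gamma> assume "qcoeff (a * b) \<gamma> \<noteq> 0"
  then obtain \<delta> where "qcoeff a \<delta> \<noteq> 0" "qcoeff b (\<gamma> - \<delta>) \<noteq> 0"
    by (rule qcoeff_mult_nonzeroE)
  then show "fst \<gamma> \<le> k + l \<and> snd \<gamma> \<le> 0"
    using assms(1)[unfolded fst_below_def, rule_format, of \<delta>]
      assms(2)[unfolded fst_below_def, rule_format, of "\<gamma> - \<delta>"]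
    by simp
qed

lemma fst_below_power:
  assumes "fst_below (- 1) a"
  shows "fst_below (- int n) (a ^ n)"
proof (induction n)
  case 0
  then show ?case by (auto simp: fst_below_def qcoeff_1 zero_prod_def split: if_splits)
next
  case (Suc n)
  then show ?case using fst_below_mult[OF assms Suc] by (simp add: algebra_simps)
qed

text \<open>The inverse is the sum of all powers of \<open>a\<close>. At a given exponent only
  finitely many contribute, because \<open>a ^ k\<close> lives at first coordinates at most
  \<open>- k\<close>.\<close>

lemma neumann_series:
  assumes "fst_below (- 1) a"
  obtains b where "(1 - a) * b = 1"
proof -
  have vanish: "qcoeff (a ^ k) \<gamma> = 0" if "- fst \<gamma> < int k \<or> 0 < snd \<gamma>" for k \<gamma>
    by (rule fst_belowD[OF fst_below_power[OF assms]]) (use that in auto)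
  \<comment> \<open>Powers beyond this cutoff vanish at \<gamma>. If the first coordinate is
    positive, only k = 0 remains, and its coefficient is 0 as well.\<close>
  define f where "f \<gamma> = (\<Sum>k\<le>nat (- fst \<gamma>). qcoeff (a ^ k) \<gamma>)" for \<gamma>
  have "bdd_supp f"
    by (rule bdd_suppI[of _ 0], rule supp_leI, rule ccontr)
      (auto simp: f_def vanish qcoeff_1 zero_prod_def intro!: sum.neutral)
  then obtain b where b: "qcoeff b = f" by (metis Abs_qtorus_inverse mem_Collect_eq)
  have bound: "k \<le> nat (- fst \<gamma>)" if "qcoeff (a ^ k) \<gamma> \<noteq> 0" for k \<gamma>
    using vanish[of \<gamma> k] that by (cases "int k \<le> - fst \<gamma>") auto
  have partial: "qcoeff b \<gamma> = qcoeff (\<Sum>k\<le>N. a ^ k) \<gamma>" if "- fst \<gamma> \<le> int N" for N \<gamma>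
    unfolding b f_def qcoeff_sum
    by (rule sum.mono_neutral_left) (use that in \<open>auto dest: bound\<close>)
  have "qcoeff ((1 - a) * b) \<gamma> = qcoeff 1 \<gamma>" for \<gamma>
  proof -
    \<comment> \<open>With this \<open>N\<close>, both \<open>a ^ Suc N\<close> and
      \<open>(1 - a) * d\<close> live at first coordinates strictly below that of \<gamma>.\<close>
    define N where "N = nat (- fst \<gamma>)"
    define d where "d = b - (\<Sum>k\<le>N. a ^ k)"
    have geom: "(1 - a) * (\<Sum>k\<le>n. a ^ k) = 1 - a ^ Suc n" for n
    proof (induction n)
      case (Suc n)
      have "(1 - a) * (\<Sum>k\<le>Suc n. a ^ k) = (1 - a) * (\<Sum>k\<le>n. a ^ k) + (1 - a) * a ^ Suc n"
        by (simp add: distrib_left)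
      then show ?case unfolding Suc by (simp add: left_diff_distrib)
    qed simp
    have d: "fst_below (- int N - 1) d"
      unfolding fst_below_def
    proof (intro allI impI)
      fix \<alpha> assume *: "qcoeff d \<alpha> \<noteq> 0"
      then have "\<not> - fst \<alpha> \<le> int N" using partial[of \<alpha> N] unfolding d_def by auto
      moreover have "\<not> 0 < snd \<alpha>"
        using * by (auto simp: d_def b f_def qcoeff_sum vanish)
      ultimately show "fst \<alpha> \<le> - int N - 1 \<and> snd \<alpha> \<le> 0" by auto
    qed
    have "fst_below 0 1" by (auto simp: fst_below_def qcoeff_1 zero_prod_def split: if_splits)
    then have "fst_below 0 (1 - a)"
      using assms unfolding fst_below_def by (smt (verit) qcoeff_simps(3) right_minus_eq)
    then have "fst_below (- int N - 1) ((1 - a) * d)"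
      using fst_below_mult[OF _ d] by fastforce
    then have "qcoeff ((1 - a) * d) \<gamma> = 0"
      by (rule fst_belowD) (simp add: N_def)
    moreover have "qcoeff (a ^ Suc N) \<gamma> = 0" by (rule vanish) (simp add: N_def)
    moreover have "(1 - a) * b = 1 - a ^ Suc N + (1 - a) * d"
      unfolding d_def geom[symmetric] by (simp add: algebra_simps)
    ultimately show ?thesis by simp
  qed
  then show thesis using that qtorus_eqI by blast
qed

text \<open>Division by the dominant monomial leaves 1 minus an element with negative first
  coordinates, to which the Neumann series applies.\<close>

lemma unit_of_dominant_monomial:
  assumes "qcoeff a \<alpha> = 1"
    and "\<And>\<beta>. qcoeff a \<beta> \<noteq> 0 \<Longrightarrow> \<beta> \<noteq> \<alpha> \<Longrightarrow> fst \<beta> < fst \<alpha> \<and> snd \<beta> \<le> snd \<alpha>"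
  obtains b where "a * b = 1" and "b * a = 1"
proof -
  define n where "n = 1 - X\<^bsup>- \<alpha>\<^esup> * a"
  have "fst_below (- 1) n"
    unfolding fst_below_def
  proof (intro allI impI)
    fix \<beta> assume *: "qcoeff n \<beta> \<noteq> 0"
    then have "\<beta> \<noteq> 0"
      using assms(1) by (auto simp: n_def qcoeff_1 qcoeff_qmono_mult Lam_def)
    then have "qcoeff a (\<beta> + \<alpha>) \<noteq> 0" "\<beta> + \<alpha> \<noteq> \<alpha>"
      using * by (auto simp: n_def qcoeff_1 qcoeff_qmono_mult)
    then show "fst \<beta> \<le> - 1 \<and> snd \<beta> \<le> 0" using assms(2)[of "\<beta> + \<alpha>"] by simp
  qed
  then obtain c where "(1 - n) * c = 1" by (rule neumann_series)
  then have c: "X\<^bsup>- \<alpha>\<^esup> * a * c = 1" by (simp add: n_def)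
  have X: "X\<^bsup>\<alpha>\<^esup> * X\<^bsup>- \<alpha>\<^esup> = 1" by (simp add: qmono_mult Lam_def)
  have "a * c = X\<^bsup>\<alpha>\<^esup>"
    by (metis X c mult.assoc mult_1_left mult_1_right)
  then have ab: "a * (c * X\<^bsup>- \<alpha>\<^esup>) = 1" using X by (simp add: mult.assoc[symmetric])
  \<comment> \<open>Without zero divisors a right inverse is also a left inverse.\<close>
  moreover have "c * X\<^bsup>- \<alpha>\<^esup> * a = 1"
  proof (rule qtorus_cancel_left[of a])
    show "a \<noteq> 0" using ab by auto
    show "a * (c * X\<^bsup>- \<alpha>\<^esup> * a) = a * 1" by (metis ab mult.assoc mult_1_left mult_1_right)
  qed
  ultimately show thesis by (rule that)
qed

section \<open>Integer powers and commutation up to powers of \<open>\<nu>\<close>\<close>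

text \<open>The second argument stands for the inverse of the first; it is passed explicitly because
  not every nonzero element of the completion is a unit.\<close>

definition ipow :: "qtorus \<Rightarrow> qtorus \<Rightarrow> int \<Rightarrow> qtorus"
  where "ipow a b n = (if 0 \<le> n then a ^ nat n else b ^ nat (- n))"

lemma ipow_simps [simp]: "ipow a b 0 = 1" "ipow a b 1 = a" "ipow a b (- 1) = b"
  by (simp_all add: ipow_def)

lemma ipow_succ:
  assumes "a * b = 1"
  shows "ipow a b (1 + n) = a * ipow a b n"
proof (cases "0 \<le> n")
  case True
  then have "nat (1 + n) = Suc (nat n)" by simp
  with True show ?thesis by (simp add: ipow_def)
next
  case False
  then have "nat (- n) = Suc (nat (- 1 - n))" by simp
  then have "a * ipow a b n = (a * b) * b ^ nat (- 1 - n)"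
    using False by (simp add: ipow_def mult.assoc)
  with False assms show ?thesis by (simp add: ipow_def)
qed

lemma ipow_pred:
  assumes "a * b = 1" and "b * a = 1"
  shows "ipow a b (n - 1) = b * ipow a b n"
  using ipow_succ[OF assms(1), of "n - 1"] assms(2) by (simp add: mult.assoc[symmetric])

lemma ipow_add:
  assumes "a * b = 1" and "b * a = 1"
  shows "ipow a b (m + n) = ipow a b m * ipow a b n"
proof (induction m rule: int_induct[where k = 0])
  case (step1 m)
  then show ?case using ipow_succ[OF assms(1), of "m + n"]
    by (simp add: ipow_succ[OF assms(1), of m] algebra_simps)
next
  case (step2 m)
  then show ?case using ipow_pred[OF assms, of "m + n"]
    by (simp add: ipow_pred[OF assms, of m] algebra_simps)
qed simp

text \<open>Quasi-commutation. For fixed \<open>a\<close> the exponent is additive in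
  \<open>b\<close>, hence linear along the integer powers of a unit.\<close>

definition qcomm :: "int \<Rightarrow> qtorus \<Rightarrow> qtorus \<Rightarrow> bool"
  where "qcomm k a b \<longleftrightarrow> a * b = \<nu>\<^bsup>k\<^esup> *\<^sub>\<nu> (b * a)"

lemma qcomm_1: "qcomm 0 a 1"
  by (simp add: qcomm_def)

lemma qcomm_sym: "qcomm k a b \<Longrightarrow> qcomm (- k) b a"
  by (simp add: qcomm_def nu_pow_mult)

lemma qcomm_mult:
  assumes "qcomm k a b" and "qcomm l a c"
  shows "qcomm (k + l) a (b * c)"
proof -
  have "a * (b * c) = \<nu>\<^bsup>k\<^esup> *\<^sub>\<nu> (b * (a * c))"
    using assms(1) by (simp add: qcomm_def mult.assoc[symmetric] qscale_mult_left)
  then show ?thesis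
    using assms(2) by (simp add: qcomm_def qscale_mult_right nu_pow_mult mult.assoc)
qed

lemma qcomm_inverse:
  assumes "qcomm k a b" and "b * b' = 1" and "b' * b = 1"
  shows "qcomm (- k) a b'"
proof -
  have "b' * (a * b) * b' = \<nu>\<^bsup>k\<^esup> *\<^sub>\<nu> (b' * b * a * b')"
    using assms(1) by (simp add: qcomm_def qscale_push mult.assoc)
  moreover have "b' * (a * b) * b' = b' * a"
    using assms(2) by (simp add: mult.assoc)
  ultimately show ?thesis using assms(3) by (simp add: qcomm_def nu_pow_mult)
qed

lemma qcomm_ipow:
  assumes "qcomm k a b" and "b * b' = 1" and "b' * b = 1"
  shows "qcomm (k * n) a (ipow b b' n)"
proof (induction n rule: int_induct[where k = 0])
  case base
  then show ?case by (simp add: qcomm_1)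
next
  case (step1 n)
  then show ?case using qcomm_mult[OF assms(1) step1(2)]
    by (simp add: ipow_succ[OF assms(2)] algebra_simps)
next
  case (step2 n)
  then show ?case using qcomm_mult[OF qcomm_inverse[OF assms] step2(2)]
    by (simp add: ipow_pred[OF assms(2,3)] algebra_simps)
qed

lemma leading_qscale: "leading a \<alpha> \<Longrightarrow> leading (\<nu>\<^bsup>k\<^esup> *\<^sub>\<nu> a) \<alpha>"
  by (auto simp: leading_def nu_pow_nonzero)

lemma leading_ipow:
  assumes "leading a (i, j)" and "a * b = 1" and "b * a = 1"
  shows "leading (ipow a b n) (n * i, n * j)"
proof (induction n rule: int_induct[where k = 0])
  case base
  then show ?case using leading_1 by (simp add: zero_prod_def)
next
  case (step1 n)
  then show ?case using leading_mult[OF assms(1) step1(2)]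
    by (simp add: ipow_succ[OF assms(2)] algebra_simps)
next
  case (step2 n)
  then show ?case using leading_mult[OF leading_inverse[OF assms(1,2)] step2(2)]
    by (simp add: ipow_pred[OF assms(2,3)] algebra_simps)
qed

section \<open>Homomorphisms out of the quantum torus\<close>

lemma quantum_torus_subalgebra: "subalgebra quantum_torus"
  unfolding subalgebra_def
proof (intro conjI ballI)
  show "qtorus.subspace quantum_torus"
  proof (rule qtorus.subspaceI)
    fix a b c assume ab: "a \<in> quantum_torus" "b \<in> quantum_torus"
    have "{\<alpha>. qcoeff (a + b) \<alpha> \<noteq> 0} \<subseteq> {\<alpha>. qcoeff a \<alpha> \<noteq> 0} \<union> {\<alpha>. qcoeff b \<alpha> \<noteq> 0}" by auto
    with ab show "a + b \<in> quantum_torus"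
      unfolding quantum_torus_def by (simp add: finite_subset)
    have "{\<alpha>. qcoeff (c *\<^sub>\<nu> a) \<alpha> \<noteq> 0} \<subseteq> {\<alpha>. qcoeff a \<alpha> \<noteq> 0}" by auto
    with ab show "c *\<^sub>\<nu> a \<in> quantum_torus"
      unfolding quantum_torus_def by (simp add: finite_subset)
  qed (simp add: quantum_torus_def)
  show "1 \<in> quantum_torus"
    by (simp add: quantum_torus_def qcoeff_1)
  fix a b assume ab: "a \<in> quantum_torus" "b \<in> quantum_torus"
  have "{\<gamma>. qcoeff (a * b) \<gamma> \<noteq> 0} \<subseteq>
      (\<lambda>(\<alpha>, \<beta>). \<alpha> + \<beta>) ` ({\<alpha>. qcoeff a \<alpha> \<noteq> 0} \<times> {\<beta>. qcoeff b \<beta> \<noteq> 0})"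
  proof
    fix \<gamma> assume "\<gamma> \<in> {\<gamma>. qcoeff (a * b) \<gamma> \<noteq> 0}"
    then obtain \<alpha> where "qcoeff a \<alpha> \<noteq> 0" "qcoeff b (\<gamma> - \<alpha>) \<noteq> 0"
      by (auto elim: qcoeff_mult_nonzeroE)
    then show "\<gamma> \<in> (\<lambda>(\<alpha>, \<beta>). \<alpha> + \<beta>) ` ({\<alpha>. qcoeff a \<alpha> \<noteq> 0} \<times> {\<beta>. qcoeff b \<beta> \<noteq> 0})"
      by (intro image_eqI[of _ _ "(\<alpha>, \<gamma> - \<alpha>)"]) auto
  qed
  then show "a * b \<in> quantum_torus"
    using ab finite_subset unfolding quantum_torus_def by blast
qed

lemma qmono_in_quantum_torus: "X\<^bsup>\<alpha>\<^esup> \<in> quantum_torus"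
  by (simp add: quantum_torus_def qcoeff_qmono)

lemma
  shows quantum_torus_scale: "a \<in> quantum_torus \<Longrightarrow> c *\<^sub>\<nu> a \<in> quantum_torus"
    and quantum_torus_add: "a \<in> quantum_torus \<Longrightarrow> b \<in> quantum_torus \<Longrightarrow> a + b \<in> quantum_torus"
    and quantum_torus_diff: "a \<in> quantum_torus \<Longrightarrow> b \<in> quantum_torus \<Longrightarrow> a - b \<in> quantum_torus"
    and quantum_torus_mult: "a \<in> quantum_torus \<Longrightarrow> b \<in> quantum_torus \<Longrightarrow> a * b \<in> quantum_torus"
    and quantum_torus_sum: "(\<And>i. i \<in> S \<Longrightarrow> f i \<in> quantum_torus) \<Longrightarrow> sum f S \<in> quantum_torus"
  using quantum_torus_subalgebra unfolding subalgebra_def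
  by (blast intro: qtorus.subspace_scale qtorus.subspace_add qtorus.subspace_diff
      qtorus.subspace_sum)+

text \<open>The linear extension of \<open>E\<close> from monomials. A sum over an infinite set is 0
  in HOL, so the map has its meaning only on \<open>quantum_torus\<close>.\<close>

definition torus_map :: "(int \<times> int \<Rightarrow> qtorus) \<Rightarrow> qtorus \<Rightarrow> qtorus"
  where "torus_map E a = (\<Sum>\<alpha> | qcoeff a \<alpha> \<noteq> 0. qcoeff a \<alpha> *\<^sub>\<nu> E \<alpha>)"

lemma torus_map_eq:
  assumes "finite S" and "{\<alpha>. qcoeff a \<alpha> \<noteq> 0} \<subseteq> S"
  shows "torus_map E a = (\<Sum>\<alpha>\<in>S. qcoeff a \<alpha> *\<^sub>\<nu> E \<alpha>)"
  unfolding torus_map_def by (rule sum.mono_neutral_left) (use assms in auto)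

lemma torus_map_qmono [simp]: "torus_map E X\<^bsup>\<alpha>\<^esup> = E \<alpha>"
  by (subst torus_map_eq[of "{\<alpha>}"]) (auto simp: qcoeff_qmono)

lemma torus_map_add:
  assumes "a \<in> quantum_torus" and "b \<in> quantum_torus"
  shows "torus_map E (a + b) = torus_map E a + torus_map E b"
proof -
  let ?S = "{\<alpha>. qcoeff a \<alpha> \<noteq> 0} \<union> {\<alpha>. qcoeff b \<alpha> \<noteq> 0}"
  have S: "finite ?S" using assms by (simp add: quantum_torus_def)
  have "torus_map E c = (\<Sum>\<alpha>\<in>?S. qcoeff c \<alpha> *\<^sub>\<nu> E \<alpha>)" if "c \<in> {a, b, a + b}" for c
    by (rule torus_map_eq[OF S]) (use that in auto)
  then show ?thesis
    by (simp add: sum.distrib[symmetric] qtorus.scale_left_distrib)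
qed

lemma torus_map_scale:
  assumes "a \<in> quantum_torus"
  shows "torus_map E (c *\<^sub>\<nu> a) = c *\<^sub>\<nu> torus_map E a"
proof -
  let ?S = "{\<alpha>. qcoeff a \<alpha> \<noteq> 0}"
  have S: "finite ?S" using assms by (simp add: quantum_torus_def)
  have "torus_map E (c *\<^sub>\<nu> a) = (\<Sum>\<alpha>\<in>?S. qcoeff (c *\<^sub>\<nu> a) \<alpha> *\<^sub>\<nu> E \<alpha>)"
    by (rule torus_map_eq[OF S]) auto
  also have "\<dots> = c *\<^sub>\<nu> torus_map E a"
    unfolding torus_map_def by (simp add: qtorus.scale_sum_right)
  finally show ?thesis .
qed

lemma torus_map_sum:
  assumes "\<And>i. i \<in> S \<Longrightarrow> f i \<in> quantum_torus"
  shows "torus_map E (sum f S) = (\<Sum>i\<in>S. torus_map E (f i))"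
  using assms
proof (induction S rule: infinite_finite_induct)
  case (insert x S)
  then show ?case by (simp add: torus_map_add quantum_torus_sum)
qed (simp_all add: torus_map_def)

lemma quantum_torus_expansion:
  assumes "a \<in> quantum_torus"
  shows "a = (\<Sum>\<alpha> | qcoeff a \<alpha> \<noteq> 0. qcoeff a \<alpha> *\<^sub>\<nu> X\<^bsup>\<alpha>\<^esup>)"
proof (rule qtorus_eqI)
  fix \<beta>
  have "finite {\<alpha>. qcoeff a \<alpha> \<noteq> 0}" using assms by (simp add: quantum_torus_def)
  then show "qcoeff a \<beta> = qcoeff (\<Sum>\<alpha> | qcoeff a \<alpha> \<noteq> 0. qcoeff a \<alpha> *\<^sub>\<nu> X\<^bsup>\<alpha>\<^esup>) \<beta>"
    by (simp add: qcoeff_sum qcoeff_qmono if_distrib[of "(*) _"] cong: if_cong)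
qed

lemma torus_map_mult:
  assumes E: "\<And>\<alpha> \<beta>. E \<alpha> * E \<beta> = \<nu>\<^bsup>Lam \<alpha> \<beta>\<^esup> *\<^sub>\<nu> E (\<alpha> + \<beta>)"
    and a: "a \<in> quantum_torus" and b: "b \<in> quantum_torus"
  shows "torus_map E (a * b) = torus_map E a * torus_map E b"
proof -
  let ?A = "{\<alpha>. qcoeff a \<alpha> \<noteq> 0}" and ?B = "{\<alpha>. qcoeff b \<alpha> \<noteq> 0}"
  have "a * b = (\<Sum>\<alpha>\<in>?A. qcoeff a \<alpha> *\<^sub>\<nu> X\<^bsup>\<alpha>\<^esup>) * (\<Sum>\<beta>\<in>?B. qcoeff b \<beta> *\<^sub>\<nu> X\<^bsup>\<beta>\<^esup>)"
    using quantum_torus_expansion[OF a] quantum_torus_expansion[OF b] by simp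
  also have "\<dots> = (\<Sum>\<alpha>\<in>?A. \<Sum>\<beta>\<in>?B.
      (qcoeff b \<beta> * (qcoeff a \<alpha> * \<nu>\<^bsup>Lam \<alpha> \<beta>\<^esup>)) *\<^sub>\<nu> X\<^bsup>\<alpha> + \<beta>\<^esup>)"
    by (simp add: sum_product qscale_mult_left qscale_mult_right qmono_mult)
  finally have "torus_map E (a * b) = (\<Sum>\<alpha>\<in>?A. \<Sum>\<beta>\<in>?B.
      (qcoeff b \<beta> * (qcoeff a \<alpha> * \<nu>\<^bsup>Lam \<alpha> \<beta>\<^esup>)) *\<^sub>\<nu> E (\<alpha> + \<beta>))"
    by (simp add: torus_map_sum torus_map_scale quantum_torus_sum quantum_torus_scale
        qmono_in_quantum_torus)
  also have "\<dots> = torus_map E a * torus_map E b"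
    by (simp add: torus_map_def sum_product qscale_mult_left qscale_mult_right E)
  finally show ?thesis .
qed

text \<open>The map \<open>(i, j) \<mapsto> (i, i + j)\<close> is strictly increasing for the lexicographic order, so the leading
  terms of the summands cannot cancel.\<close>

lemma torus_map_nonzero:
  assumes "\<And>i j. leading (E (i, j)) (i, i + j)"
    and a: "a \<in> quantum_torus" "a \<noteq> 0"
  shows "torus_map E a \<noteq> 0"
proof -
  obtain i j where lead: "leading a (i, j)"
    using leading_exists[OF a(2)] by (metis surj_pair)
  let ?A = "{\<alpha>. qcoeff a \<alpha> \<noteq> 0}"
  have other: "qcoeff (E \<beta>) (i, i + j) = 0" if "\<beta> \<in> ?A - {(i, j)}" for \<beta>
  proof (rule ccontr)
    assume "qcoeff (E \<beta>) (i, i + j) \<noteq> 0"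
    then have "lex_le (i, i + j) (fst \<beta>, fst \<beta> + snd \<beta>)"
      using assms(1)[of "fst \<beta>" "snd \<beta>"] by (simp add: leading_def)
    moreover have "lex_le \<beta> (i, j)" using that lead unfolding leading_def by blast
    ultimately show False using that by (auto simp: lex_le_def prod_eq_iff)
  qed
  have "finite ?A" using a by (simp add: quantum_torus_def)
  then have "qcoeff (torus_map E a) (i, i + j) =
      qcoeff a (i, j) * qcoeff (E (i, j)) (i, i + j)"
    using lead other unfolding torus_map_def qcoeff_sum
    by (subst sum.remove[of _ "(i, j)"]) (auto simp: leading_def intro!: sum.neutral)
  then have "qcoeff (torus_map E a) (i, i + j) \<noteq> 0"
    using lead assms(1)[of i j] by (simp add: leading_def)
  then show ?thesis by auto
qed

section \<open>Algebra isomorphisms onto images\<close>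

text \<open>Injectivity of an additive map amounts to a zero kernel, which the leading terms
  provide.\<close>

lemma algebra_iso_torus_map:
  assumes "\<And>\<alpha> \<beta>. E \<alpha> * E \<beta> = \<nu>\<^bsup>Lam \<alpha> \<beta>\<^esup> *\<^sub>\<nu> E (\<alpha> + \<beta>)"
    and "E 0 = 1" and "\<And>i j. leading (E (i, j)) (i, i + j)"
  shows "algebra_iso (torus_map E) quantum_torus (torus_map E ` quantum_torus)"
proof -
  have "inj_on (torus_map E) quantum_torus"
  proof (rule inj_onI)
    fix a b assume ab: "a \<in> quantum_torus" "b \<in> quantum_torus" "torus_map E a = torus_map E b"
    then have "torus_map E (a - b) + torus_map E b = 0 + torus_map E b"
      using torus_map_add[of "a - b" b E] by (simp add: quantum_torus_diff)
    then have "torus_map E (a - b) = 0" by simp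
    then show "a = b"
      using torus_map_nonzero[of E "a - b"] assms(3) ab by (auto simp: quantum_torus_diff)
  qed
  moreover have "torus_map E 1 = 1"
    using torus_map_qmono[of E 0] assms(2) by simp
  ultimately show ?thesis
    unfolding algebra_iso_def bij_betw_def
    by (simp add: torus_map_add torus_map_scale torus_map_mult[of E] assms(1))
qed

lemma subalgebra_image:
  assumes "algebra_iso \<phi> A B" and "subalgebra A"
  shows "subalgebra B"
proof -
  have B: "B = \<phi> ` A" using assms(1) by (auto simp: algebra_iso_def bij_betw_def)
  have sub: "qtorus.subspace A" using assms(2) by (simp add: subalgebra_def)
  then have 0: "0 \<in> A" by (rule qtorus.subspace_0)
  \<comment> \<open>Preservation of 0 follows from compatibility with scaling by 0.\<close>
  have \<phi>0: "\<phi> 0 = 0"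
    using assms(1) 0 unfolding algebra_iso_def by (metis qtorus.scale_zero_left)
  have "qtorus.subspace B"
  proof (rule qtorus.subspaceI)
    show "0 \<in> B" using 0 \<phi>0 unfolding B by (metis imageI)
  next
    fix x y assume "x \<in> B" "y \<in> B"
    then obtain a b where ab: "a \<in> A" "b \<in> A" "x = \<phi> a" "y = \<phi> b" unfolding B by blast
    then have "x + y = \<phi> (a + b)" using assms(1) by (simp add: algebra_iso_def)
    then show "x + y \<in> B" using qtorus.subspace_add[OF sub ab(1,2)] B by blast
  next
    fix c x assume "x \<in> B"
    then obtain a where a: "a \<in> A" "x = \<phi> a" unfolding B by blast
    then have "c *\<^sub>\<nu> x = \<phi> (c *\<^sub>\<nu> a)" using assms(1) by (simp add: algebra_iso_def)
    then show "c *\<^sub>\<nu> x \<in> B" using qtorus.subspace_scale[OF sub a(1)] B by blast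
  qed
  moreover have "1 \<in> B"
    using assms unfolding B algebra_iso_def subalgebra_def by (metis imageI)
  moreover have "x * y \<in> B" if xy: "x \<in> B" "y \<in> B" for x y
  proof -
    obtain a b where ab: "a \<in> A" "b \<in> A" "x = \<phi> a" "y = \<phi> b" using xy unfolding B by blast
    then have "x * y = \<phi> (a * b)" using assms(1) by (simp add: algebra_iso_def)
    then show ?thesis using ab(1,2) assms(2) B unfolding subalgebra_def by blast
  qed
  ultimately show ?thesis by (simp add: subalgebra_def)
qed

section \<open>Restriction to generated subalgebras\<close>

lemma algebra_iso_restrict:
  assumes "algebra_iso \<phi> A B" and "C \<subseteq> A"
  shows "algebra_iso \<phi> C (\<phi> ` C)"
  using assms inj_on_subset[of \<phi> A C] unfolding algebra_iso_def bij_betw_def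
  by (simp add: subset_iff)

lemma subalgebra_hull: "subalgebra (subalgebra hull S)"
proof (rule hull_in)
  fix T :: "qtorus set set" assume "Ball T subalgebra"
  then show "subalgebra (\<Inter> T)"
    unfolding subalgebra_def by (auto intro: qtorus.subspace_Inter)
qed

text \<open>Minimality of the hull is used on both sides: the image of the hull of \<open>S\<close>
  is a subalgebra containing the image of \<open>S\<close>, and the preimage in \<open>A\<close> of
  the other hull is a subalgebra containing \<open>S\<close>.\<close>

lemma algebra_iso_hull_image:
  assumes iso: "algebra_iso \<phi> A B" and A: "subalgebra A" and S: "S \<subseteq> A"
  shows "algebra_iso \<phi> (subalgebra hull S) (subalgebra hull (\<phi> ` S))"
proof -
  let ?H = "subalgebra hull S"
  have HA: "?H \<subseteq> A" using S A by (rule hull_minimal)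
  have iso_H: "algebra_iso \<phi> ?H (\<phi> ` ?H)" by (rule algebra_iso_restrict[OF iso HA])
  have "subalgebra hull (\<phi> ` S) \<subseteq> \<phi> ` ?H"
    by (rule hull_minimal[where S = subalgebra])
      (auto intro: hull_inc subalgebra_image[OF iso_H subalgebra_hull])
  moreover have "\<phi> ` ?H \<subseteq> subalgebra hull (\<phi> ` S)"
  proof -
    let ?K = "subalgebra hull (\<phi> ` S)"
    have K: "subalgebra ?K" by (rule subalgebra_hull)
    have \<phi>0: "\<phi> 0 = 0"
      using iso A unfolding algebra_iso_def subalgebra_def
      by (metis qtorus.scale_zero_left qtorus.subspace_0)
    have "subalgebra {a \<in> A. \<phi> a \<in> ?K}"
      using iso A K \<phi>0 unfolding subalgebra_def qtorus.subspace_def algebra_iso_def by simp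
    moreover have "S \<subseteq> {a \<in> A. \<phi> a \<in> ?K}" using S by (auto intro: hull_inc)
    ultimately have "?H \<subseteq> {a \<in> A. \<phi> a \<in> ?K}" by (metis hull_minimal)
    then show ?thesis by blast
  qed
  ultimately show ?thesis using iso_H by simp
qed

section \<open>The exchange relations for the projective line\<close>

text \<open>For \<open>n = 2s \<ge> 0\<close> this is the quantum integer \<open>\<nu>\<^sup>-\<^sup>2\<^sup>s + \<dots> + \<nu>\<^sup>2\<^sup>s\<close>; indexing by \<open>n\<close> and padding
  with zeros elsewhere makes \<open>qint n\<close> the coefficient of \<open>X_O (- l)\<close> at \<open>(- l - 1 - n, - 1)\<close>.\<close>

definition qint :: "int \<Rightarrow> laurent"
  where "qint n = (if even n \<and> 0 \<le> n
    then \<nu>\<^bsup>- n\<^esup> * (\<Sum>k\<le>nat (n div 2). \<nu>\<^bsup>4 * int k\<^esup>) else 0)"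

lemma qint_even: "qint (2 * int n) = \<nu>\<^bsup>- (2 * int n)\<^esup> * (\<Sum>k\<le>n. \<nu>\<^bsup>4 * int k\<^esup>)"
  by (simp add: qint_def)

text \<open>The scaled predecessor cancels all terms but one: the factor of exponent 2 leaves the
  lowest term, that of exponent -2 the highest. The zero padding settles n = 0 and odd or negative
  n.\<close>

lemma
  shows qint_diff: "qint n - \<nu>\<^bsup>2\<^esup> * qint (n - 2) = (if even n \<and> 0 \<le> n then \<nu>\<^bsup>- n\<^esup> else 0)"
    and qint_diff': "qint n - \<nu>\<^bsup>- 2\<^esup> * qint (n - 2) = (if even n \<and> 0 \<le> n then \<nu>\<^bsup>n\<^esup> else 0)"
proof -
  have "qint n - \<nu>\<^bsup>2\<^esup> * qint (n - 2) = (if even n \<and> 0 \<le> n then \<nu>\<^bsup>- n\<^esup> else 0) \<and>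
    qint n - \<nu>\<^bsup>- 2\<^esup> * qint (n - 2) = (if even n \<and> 0 \<le> n then \<nu>\<^bsup>n\<^esup> else 0)"
  proof (cases "even n \<and> 0 \<le> n")
    case True
    then have "n = 2 * int (nat (n div 2))" by simp
    then obtain m where m: "n = 2 * int m" by blast
    show ?thesis
    proof (cases m)
      case 0
      then show ?thesis by (simp add: m qint_def)
    next
      case (Suc j)
      have n2: "n - 2 = 2 * int j" and n: "n = 2 * int (Suc j)" using m Suc by simp_all
      have "(\<Sum>k\<le>Suc j. \<nu>\<^bsup>4 * int k\<^esup>) = 1 + \<nu>\<^bsup>4\<^esup> * (\<Sum>k\<le>j. \<nu>\<^bsup>4 * int k\<^esup>)"
        by (subst sum.atMost_Suc_shift) (simp add: sum_distrib_left nu_pow_mult algebra_simps)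
      then have A: "qint n = \<nu>\<^bsup>- n\<^esup> * (1 + \<nu>\<^bsup>4\<^esup> * (\<Sum>k\<le>j. \<nu>\<^bsup>4 * int k\<^esup>))"
        using qint_even[of "Suc j"] by (simp only: n)
      have B: "qint n = \<nu>\<^bsup>- n\<^esup> * ((\<Sum>k\<le>j. \<nu>\<^bsup>4 * int k\<^esup>) + \<nu>\<^bsup>2 * n\<^esup>)"
        using qint_even[of "Suc j"] by (simp add: n)
      have C: "qint (n - 2) = \<nu>\<^bsup>2 - n\<^esup> * (\<Sum>k\<le>j. \<nu>\<^bsup>4 * int k\<^esup>)"
        unfolding n2 qint_even using n2 by (simp add: algebra_simps)
      have "qint n - \<nu>\<^bsup>2\<^esup> * qint (n - 2) = \<nu>\<^bsup>- n\<^esup>"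
        unfolding A C by (simp add: nu_pow_mult nu_pow_mult_left distrib_left)
      moreover have "qint n - \<nu>\<^bsup>- 2\<^esup> * qint (n - 2) = \<nu>\<^bsup>n\<^esup>"
        unfolding B C by (simp add: nu_pow_mult nu_pow_mult_left distrib_left)
      ultimately show ?thesis using True by simp
    qed
  next
    case False
    then show ?thesis by (auto simp: qint_def)
  qed
  then show "qint n - \<nu>\<^bsup>2\<^esup> * qint (n - 2) = (if even n \<and> 0 \<le> n then \<nu>\<^bsup>- n\<^esup> else 0)"
    and "qint n - \<nu>\<^bsup>- 2\<^esup> * qint (n - 2) = (if even n \<and> 0 \<le> n then \<nu>\<^bsup>n\<^esup> else 0)"
    by blast+
qed

section \<open>Splitting of the generators of the projective line\<close>

abbreviation head :: "int \<Rightarrow> qtorus"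
  where "head l \<equiv> X\<^bsup>(l - 1, 1)\<^esup>"

text \<open>\<open>head\<close> and \<open>tail\<close> are the P and Q of the overview. The index
  is negated to run parallel to that of \<open>X_V\<close>.\<close>

definition tail :: "int \<Rightarrow> qtorus"
  where "tail l = X_O (- l) - head l"

lemma X_O_eq: "X_O (- l) = head l + tail l"
  by (simp add: tail_def)

lemma qcoeff_tail: "qcoeff (tail l) (i, j) = (if j = - 1 then qint (- l - 1 - i) else 0)"
proof -
  have "qcoeff (tail l) (i, j) = (\<Sum>r | r \<ge> l \<and> (i, j) = - (- l + 2 * r + 1, 1).
      \<nu>\<^bsup>- 2 * (- l + r)\<^esup> * exact_quotient (\<nu>\<^bsup>4 * (- l + r + 1)\<^esup> - 1) (\<nu>\<^bsup>4\<^esup> - 1))"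
    (is "_ = ?S")
    unfolding tail_def by (simp add: X_O.rep_eq qcoeff_qmono)
  also have "\<dots> = (if j = - 1 then qint (- l - 1 - i) else 0)"
  proof (cases "j = - 1 \<and> even (- l - 1 - i) \<and> 0 \<le> - l - 1 - i")
    case True
    \<comment> \<open>The only contributing index is r = l + n.\<close>
    define n where "n = nat ((- l - 1 - i) div 2)"
    have n: "- l - 1 - i = 2 * int n" using True by (simp add: n_def)
    then have "{r. r \<ge> l \<and> (i, j) = - (- l + 2 * r + 1, 1)} = {l + int n}"
      using True by auto
    then have "?S = \<nu>\<^bsup>- (2 * int n)\<^esup> * (\<Sum>k\<le>n. \<nu>\<^bsup>4 * int k\<^esup>)"
      using exact_quotient_nu[of n] by simp
    then show ?thesis using True by (simp only: n qint_even simp_thms if_True)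
  next
    case False
    have "\<not> (r \<ge> l \<and> (i, j) = - (- l + 2 * r + 1, 1))" for r
    proof
      assume "r \<ge> l \<and> (i, j) = - (- l + 2 * r + 1, 1)"
      then have "j = - 1" "- l - 1 - i = 2 * (r - l)" "r \<ge> l" by auto
      with False show False by simp
    qed
    then have "{r. r \<ge> l \<and> (i, j) = - (- l + 2 * r + 1, 1)} = {}" by blast
    with False show ?thesis by (simp only: sum.empty) (auto simp: qint_def)
  qed
  finally show ?thesis .
qed

text \<open>A tail lies entirely at second coordinate -1, so the twist is one constant power of
  \<nu>, and the coefficients of all tails are shifts of \<open>qint\<close>.\<close>

lemma qmono_mult_tail:
  "X\<^bsup>(1, 0)\<^esup> * tail l = \<nu>\<^bsup>1\<^esup> *\<^sub>\<nu> tail (l - 1)"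
  "X\<^bsup>(- 1, 0)\<^esup> * tail l = \<nu>\<^bsup>- 1\<^esup> *\<^sub>\<nu> tail (l + 1)"
  by (rule qtorus_eqI; clarsimp simp: qcoeff_qmono_mult qcoeff_tail Lam_def algebra_simps)+

lemma tail_mult_qmono: "tail l * X\<^bsup>(1, 0)\<^esup> = \<nu>\<^bsup>- 1\<^esup> *\<^sub>\<nu> tail (l - 1)"
  by (rule qtorus_eqI; clarsimp simp: qcoeff_mult_qmono qcoeff_tail Lam_def algebra_simps)

text \<open>No product of infinite sums is expanded: the monomial of exponent (1, 0) is split off
  the left factor and absorbed by the right one.\<close>

lemma tail_exchange: "tail (l - 1) * tail (l + 1) = \<nu>\<^bsup>2\<^esup> *\<^sub>\<nu> (tail l * tail l)"
proof -
  have "tail (l - 1) * tail (l + 1) = \<nu>\<^bsup>1\<^esup> *\<^sub>\<nu> (tail l * X\<^bsup>(1, 0)\<^esup> * tail (l + 1))"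
    by (simp add: tail_mult_qmono qscale_push)
  then show ?thesis by (simp add: mult.assoc qmono_mult_tail qscale_push)
qed

lemma tail_qcomm: "qcomm 2 (tail l) (tail (l + 1))"
proof -
  have "tail l * tail (l + 1) = \<nu>\<^bsup>1\<^esup> *\<^sub>\<nu> (tail (l + 1) * X\<^bsup>(1, 0)\<^esup> * tail (l + 1))"
    by (simp add: tail_mult_qmono qscale_push)
  then show ?thesis by (simp add: mult.assoc qmono_mult_tail qscale_push qcomm_def)
qed

text \<open>One factor is always a monomial, so everything sits at second coordinate 0 and each
  product contributes a power of \<nu> times one value of \<open>qint\<close>.\<close>

lemma mixed_exchange:
  "head (l - 1) * tail (l + 1) + tail (l - 1) * head (l + 1)
    - \<nu>\<^bsup>2\<^esup> *\<^sub>\<nu> (head l * tail l + tail l * head l) = 1"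
proof (rule qtorus_eqI)
  fix \<gamma> :: "int \<times> int"
  obtain i j where \<gamma>: "\<gamma> = (i, j)" by (cases \<gamma>)
  show "qcoeff (head (l - 1) * tail (l + 1) + tail (l - 1) * head (l + 1)
      - \<nu>\<^bsup>2\<^esup> *\<^sub>\<nu> (head l * tail l + tail l * head l)) \<gamma> = qcoeff 1 \<gamma>"
  proof (cases "j = 0")
    case True
    define n where "n = - i"
    have i: "i = - n" by (simp add: n_def)
    have "qcoeff (head (l - 1) * tail (l + 1) + tail (l - 1) * head (l + 1)
        - \<nu>\<^bsup>2\<^esup> *\<^sub>\<nu> (head l * tail l + tail l * head l)) \<gamma> =
      \<nu>\<^bsup>- n\<^esup> * qint (n - 4) + \<nu>\<^bsup>n\<^esup> * qint n - \<nu>\<^bsup>2\<^esup> * (\<nu>\<^bsup>- n\<^esup> * qint (n - 2) + \<nu>\<^bsup>n\<^esup> * qint (n - 2))"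
      by (simp add: \<gamma> True i qcoeff_qmono_mult qcoeff_mult_qmono qcoeff_tail Lam_def algebra_simps)
    \<comment> \<open>The first bracket is \<nu>^(-n) for even n >= 0, the second \<nu>^(n - 2) for
      even n >= 2, and both are 0 otherwise. With their prefactors each gives 1, so only n = 0
      survives.\<close>
    also have "\<dots> = \<nu>\<^bsup>n\<^esup> * (qint n - \<nu>\<^bsup>2\<^esup> * qint (n - 2))
        - \<nu>\<^bsup>2 - n\<^esup> * (qint (n - 2) - \<nu>\<^bsup>- 2\<^esup> * qint (n - 2 - 2))"
      by (simp add: right_diff_distrib distrib_left nu_pow_mult_left algebra_simps)
    also have "\<dots> = (if n = 0 then 1 else 0)"
      unfolding qint_diff qint_diff' by (auto simp: nu_pow_mult)
    finally show ?thesis by (simp add: \<gamma> True i qcoeff_1 zero_prod_def)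
  next
    case False
    then show ?thesis
      by (simp add: \<gamma> qcoeff_qmono_mult qcoeff_mult_qmono qcoeff_tail qcoeff_1 zero_prod_def)
  qed
qed

lemma mixed_qcomm:
  "head l * tail (l + 1) + tail l * head (l + 1)
    = \<nu>\<^bsup>2\<^esup> *\<^sub>\<nu> (head (l + 1) * tail l + tail (l + 1) * head l)"
proof (rule qtorus_eqI)
  fix \<gamma> :: "int \<times> int"
  obtain i j where \<gamma>: "\<gamma> = (i, j)" by (cases \<gamma>)
  show "qcoeff (head l * tail (l + 1) + tail l * head (l + 1)) \<gamma>
    = qcoeff (\<nu>\<^bsup>2\<^esup> *\<^sub>\<nu> (head (l + 1) * tail l + tail (l + 1) * head l)) \<gamma>" (is "?L = ?R")
  proof (cases "j = 0")
    case True
    define n where "n = - i - 1"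
    have i: "i = - 1 - n" by (simp add: n_def)
    have "?L - ?R = (\<nu>\<^bsup>- 1 - n\<^esup> * qint (n - 2) + \<nu>\<^bsup>n + 1\<^esup> * qint n)
        - \<nu>\<^bsup>2\<^esup> * (\<nu>\<^bsup>- 1 - n\<^esup> * qint n + \<nu>\<^bsup>n + 1\<^esup> * qint (n - 2))"
      by (simp add: \<gamma> True i qcoeff_qmono_mult qcoeff_mult_qmono qcoeff_tail Lam_def algebra_simps)
    \<comment> \<open>Both brackets are now nonzero for the same n, where each contributes \<nu>, so
      they cancel.\<close>
    also have "\<dots> = \<nu>\<^bsup>n + 1\<^esup> * (qint n - \<nu>\<^bsup>2\<^esup> * qint (n - 2))
        - \<nu>\<^bsup>1 - n\<^esup> * (qint n - \<nu>\<^bsup>- 2\<^esup> * qint (n - 2))"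
      by (simp add: right_diff_distrib distrib_left nu_pow_mult_left)
    also have "\<dots> = 0"
      unfolding qint_diff qint_diff' by (simp add: nu_pow_mult)
    finally show ?thesis by simp
  next
    case False
    then show ?thesis
      by (simp add: \<gamma> qcoeff_qmono_mult qcoeff_mult_qmono qcoeff_tail)
  qed
qed

section \<open>Relations between the generators\<close>

lemma X_O_exchange: "X_O (- (l - 2)) * X_O (- l) = \<nu>\<^bsup>2\<^esup> *\<^sub>\<nu> (X_O (- (l - 1)))\<^sup>2 + 1"
proof -
  define m where "m = l - 1"
  have "head (m - 1) * head (m + 1) = \<nu>\<^bsup>2\<^esup> *\<^sub>\<nu> (head m * head m)"
    by (simp add: qmono_mult Lam_def nu_pow_mult)
  \<comment> \<open>The product splits by second coordinate: 2 for head times head, 0 for the mixed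
    terms, -2 for tail times tail. Only the mixed part leaves a 1.\<close>
  then have "X_O (- (m - 1)) * X_O (- (m + 1)) - \<nu>\<^bsup>2\<^esup> *\<^sub>\<nu> (X_O (- m) * X_O (- m)) = 1"
    using mixed_exchange[of m] tail_exchange[of m]
    unfolding X_O_eq distrib_left distrib_right qtorus.scale_right_distrib
    by (simp add: algebra_simps)
  moreover have "l - 2 = m - 1" "l = m + 1" "l - 1 = m" by (simp_all add: m_def)
  ultimately show ?thesis by (metis diff_add_cancel add.commute power2_eq_square)
qed

lemma X_O_qcomm: "qcomm 2 (X_O (- l)) (X_O (- (l + 1)))"
proof -
  have "head l * head (l + 1) = \<nu>\<^bsup>2\<^esup> *\<^sub>\<nu> (head (l + 1) * head l)"
    by (simp add: qmono_mult Lam_def nu_pow_mult)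
  then show ?thesis
    using mixed_qcomm[of l] tail_qcomm[of l]
    unfolding X_O_eq qcomm_def distrib_left distrib_right qtorus.scale_right_distrib
    by (simp add: algebra_simps)
qed

text \<open>The two monomials of \<open>z\<close> shift heads and tails in opposite directions, with
  powers of \<nu> such that each head meets its own tail again. Unlike the exchange relation, this
  reaches a neighbour without division.\<close>

lemma X_O_recurrence:
  defines "z \<equiv> X\<^bsup>(1, 0)\<^esup> + X\<^bsup>(- 1, 0)\<^esup>"
  shows "z * X_O (- l) = \<nu>\<^bsup>- 1\<^esup> *\<^sub>\<nu> X_O (- (l + 1)) + \<nu>\<^bsup>1\<^esup> *\<^sub>\<nu> X_O (- (l - 1))"
  unfolding z_def X_O_eq distrib_left distrib_right qtorus.scale_right_distrib
    qmono_mult_tail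
  by (simp add: qmono_mult Lam_def algebra_simps)

text \<open>For l >= 1 the tail starts at first coordinate - l - 1, to the left of the head at l -
  1.\<close>

lemma X_O_dominant:
  assumes "1 \<le> l"
  shows "qcoeff (X_O (- l)) (l - 1, 1) = 1"
    and "qcoeff (X_O (- l)) \<beta> \<noteq> 0 \<Longrightarrow> \<beta> \<noteq> (l - 1, 1) \<Longrightarrow>
      fst \<beta> < fst (l - 1, 1 :: int) \<and> snd \<beta> \<le> snd (l - 1, 1 :: int)"
  using assms unfolding X_O_eq
  by (cases \<beta>; auto simp: qcoeff_qmono qcoeff_tail qint_def split: if_splits)+

lemma X_O_leading:
  assumes "1 \<le> l"
  shows "leading (X_O (- l)) (l - 1, 1)"
  unfolding leading_def lex_le_def
  using X_O_dominant[OF assms] by (metis order_refl zero_neq_one)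

lemma X_O_nonzero: "X_O (- l) \<noteq> 0"
proof
  assume "X_O (- l) = 0"
  then have "qcoeff (X_O (- l)) (l - 1, 1) = 0" by simp
  then show False by (simp add: X_O_eq qcoeff_qmono qcoeff_tail)
qed

section \<open>Embedding the quantum torus\<close>

text \<open>The last conclusion is the quantum Laurent phenomenon: every generator is a Laurent
  polynomial in \<open>X_O (- 1)\<close> and \<open>X_O (- 2)\<close>.\<close>

lemma embedding_exists:
  obtains \<phi> where "algebra_iso \<phi> quantum_torus (\<phi> ` quantum_torus)"
    and "\<phi> X\<^bsup>(0, 1)\<^esup> = X_O (- 1)" and "\<phi> X\<^bsup>(1, 0)\<^esup> = X_O (- 2)"
    and "\<And>l. X_O (- l) \<in> \<phi> ` quantum_torus"
proof -
  define u v where "u = X_O (- 2)" and "v = X_O (- 1)"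
  obtain u' where u: "u * u' = 1" "u' * u = 1"
    using unit_of_dominant_monomial[OF X_O_dominant[of 2]] unfolding u_def by auto
  obtain v' where v: "v * v' = 1" "v' * v = 1"
    using unit_of_dominant_monomial[OF X_O_dominant[of 1]] unfolding v_def by auto
  define U V where "U = ipow u u'" and "V = ipow v v'"
  \<comment> \<open>the power of \<open>\<nu>\<close> compensates \<open>x\<^sub>1\<^sup>i x\<^sub>2\<^sup>j = \<nu>\<^bsup>- i j\<^esup> X\<^bsup>(i, j)\<^esup>\<close>\<close>
  define E where "E \<alpha> = \<nu>\<^bsup>fst \<alpha> * snd \<alpha>\<^esup> *\<^sub>\<nu> (U (fst \<alpha>) * V (snd \<alpha>))" for \<alpha>
  have vu: "qcomm 2 v u" using X_O_qcomm[of 1] by (simp add: u_def v_def)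
  have VU: "V j * U i = \<nu>\<^bsup>2 * i * j\<^esup> *\<^sub>\<nu> (U i * V j)" for i j
  proof -
    \<comment> \<open>\<open>qcomm_ipow\<close> takes powers in the second argument only; symmetry
      brings \<open>v\<close> into that place.\<close>
    have "qcomm (- (2 * i)) (U i) v"
      unfolding U_def by (rule qcomm_sym[OF qcomm_ipow[OF vu u]])
    then have "qcomm (- (2 * i) * j) (U i) (V j)"
      unfolding V_def using v by (rule qcomm_ipow)
    then show ?thesis using qcomm_sym unfolding qcomm_def by fastforce
  qed
  have E_mult: "E \<alpha> * E \<beta> = \<nu>\<^bsup>Lam \<alpha> \<beta>\<^esup> *\<^sub>\<nu> E (\<alpha> + \<beta>)" for \<alpha> \<beta>
  proof -
    obtain i j k l where \<alpha>: "\<alpha> = (i, j)" and \<beta>: "\<beta> = (k, l)" by (metis surj_pair)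
    have "U i * V j * (U k * V l) = U i * (V j * U k) * V l" by (simp add: mult.assoc)
    also have "\<dots> = \<nu>\<^bsup>2 * k * j\<^esup> *\<^sub>\<nu> (U i * U k * (V j * V l))"
      unfolding VU by (simp add: qscale_push mult.assoc)
    also have "\<dots> = \<nu>\<^bsup>2 * k * j\<^esup> *\<^sub>\<nu> (U (i + k) * V (j + l))"
      by (simp add: U_def V_def ipow_add[OF u] ipow_add[OF v])
    finally show ?thesis
      by (simp add: E_def \<alpha> \<beta> qscale_push Lam_def algebra_simps)
  qed
  have E_0: "E 0 = 1" by (simp add: E_def U_def V_def)
  \<comment> \<open>\<open>u\<close> and \<open>v\<close> have leading exponents (1, 1) and (0, 1),
    which combine to i (1, 1) + j (0, 1).\<close>
  have E_leading: "leading (E (i, j)) (i, i + j)" for i j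
  proof -
    have "leading (U i) (i, i)"
      using leading_ipow[of u 1 1 u' i] u X_O_leading[of 2] by (simp add: U_def u_def)
    moreover have "leading (V j) (0, j)"
      using leading_ipow[of v 0 1 v' j] v X_O_leading[of 1] by (simp add: V_def v_def)
    ultimately show ?thesis
      using leading_qscale[OF leading_mult] unfolding E_def by fastforce
  qed
  define \<phi> where "\<phi> = torus_map E"
  have iso: "algebra_iso \<phi> quantum_torus (\<phi> ` quantum_torus)"
    unfolding \<phi>_def by (rule algebra_iso_torus_map[OF E_mult E_0 E_leading])
  have \<phi>: "\<phi> X\<^bsup>(0, 1)\<^esup> = v" "\<phi> X\<^bsup>(1, 0)\<^esup> = u" "\<phi> X\<^bsup>(0, - 1)\<^esup> = v'" "\<phi> X\<^bsup>(- 1, 0)\<^esup> = u'"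
    by (simp_all add: \<phi>_def E_def U_def V_def)
  define I where "I = \<phi> ` quantum_torus"
  have sub: "subalgebra I"
    unfolding I_def by (rule subalgebra_image[OF iso quantum_torus_subalgebra])
  have gen: "u \<in> I" "v \<in> I" "u' \<in> I" "v' \<in> I"
    unfolding I_def \<phi>[symmetric] by (simp_all add: qmono_in_quantum_torus)
  have mult: "a * b \<in> I" if "a \<in> I" "b \<in> I" for a b
    using sub that by (simp add: subalgebra_def)
  have one: "1 \<in> I" using sub by (simp add: subalgebra_def)
  have lin: "a + b \<in> I" "a - b \<in> I" "c *\<^sub>\<nu> a \<in> I" if "a \<in> I" "b \<in> I" for a b c
    using sub that unfolding subalgebra_def
    by (blast intro: qtorus.subspace_add qtorus.subspace_diff qtorus.subspace_scale)+
  \<comment> \<open>The exchange relation around index 1 is solved for its outer term by the unit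
    \<open>u\<close>.\<close>
  have "X_O 0 * u = \<nu>\<^bsup>2\<^esup> *\<^sub>\<nu> (v * v) + 1"
    using X_O_exchange[of 2] by (simp add: u_def v_def power2_eq_square)
  then have "X_O 0 = (\<nu>\<^bsup>2\<^esup> *\<^sub>\<nu> (v * v) + 1) * u'"
    using u by (metis mult.assoc mult_1_right)
  then have X0: "X_O 0 \<in> I" using mult lin one gen by simp
  define z where "z = X\<^bsup>(1, 0)\<^esup> + X\<^bsup>(- 1, 0)\<^esup>"
  \<comment> \<open>The recurrence at l = 1, solved for \<open>z\<close> by the unit
    \<open>v\<close>, places \<open>z\<close> in \<open>I\<close>.\<close>
  have "z * v = \<nu>\<^bsup>- 1\<^esup> *\<^sub>\<nu> u + \<nu>\<^bsup>1\<^esup> *\<^sub>\<nu> X_O 0"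
    using X_O_recurrence[of 1] by (simp add: z_def u_def v_def)
  then have "z = (\<nu>\<^bsup>- 1\<^esup> *\<^sub>\<nu> u + \<nu>\<^bsup>1\<^esup> *\<^sub>\<nu> X_O 0) * v'"
    using v by (metis mult.assoc mult_1_right)
  then have z: "z \<in> I" using mult lin gen X0 by simp
  \<comment> \<open>Both neighbours occur with a power of \<nu>, a unit, so the induction can leave
    the pair of indices 1 and 2 in either direction.\<close>
  have up: "X_O (- (l + 1)) = \<nu>\<^bsup>1\<^esup> *\<^sub>\<nu> (z * X_O (- l) - \<nu>\<^bsup>1\<^esup> *\<^sub>\<nu> X_O (- (l - 1)))" for l
    unfolding z_def X_O_recurrence by (simp add: qscale_push)
  have down: "X_O (- (l - 1)) = \<nu>\<^bsup>- 1\<^esup> *\<^sub>\<nu> (z * X_O (- l) - \<nu>\<^bsup>- 1\<^esup> *\<^sub>\<nu> X_O (- (l + 1)))" for l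
    unfolding z_def X_O_recurrence by (simp add: qscale_push)
  have "X_O (- l) \<in> I \<and> X_O (- (l + 1)) \<in> I" for l
  proof (induction l rule: int_induct[where k = 1])
    case base
    then show ?case using gen by (simp add: u_def v_def)
  next
    case (step1 l)
    then show ?case using up[of "l + 1"] z mult lin by simp
  next
    case (step2 l)
    then show ?case using down[of l] z mult lin by simp
  qed
  then show thesis using that[OF iso] \<phi> by (auto simp: I_def u_def v_def)
qed

section \<open>The isomorphism\<close>

text \<open>Two consecutive members determine both neighbours. The induction runs outwards from the
  indices 1 and 2 and cancels a member on which the families already agree, nonzero as a member of
  \<open>F\<close>.\<close>

lemma kronecker_family_unique:
  assumes "kronecker_family F" and "\<And>l. F l \<noteq> 0" and "kronecker_family G"
  shows "G = F"
proof
  fix l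
  have F: "F (k - 2) * F k = \<nu>\<^bsup>2\<^esup> *\<^sub>\<nu> (F (k - 1))\<^sup>2 + 1"
    and G: "G (k - 2) * G k = \<nu>\<^bsup>2\<^esup> *\<^sub>\<nu> (G (k - 1))\<^sup>2 + 1" for k
    using assms(1,3) by (simp_all add: kronecker_family_def)
  have "G l = F l \<and> G (l + 1) = F (l + 1)"
  proof (induction l rule: int_induct[where k = 1])
    case base
    then show ?case using assms(1,3) by (simp add: kronecker_family_def)
  next
    case (step1 l)
    then have "F l * G (l + 2) = F l * F (l + 2)"
      using F[of "l + 2"] G[of "l + 2"] by (simp add: add.commute)
    then have "G (l + 2) = F (l + 2)" by (rule qtorus_cancel_left[OF assms(2)])
    then show ?case using step1 by (simp add: add.assoc)
  next
    case (step2 l)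
    then have "G (l - 1) * F (l + 1) = F (l - 1) * F (l + 1)"
      using F[of "l + 1"] G[of "l + 1"] by simp
    then have "G (l - 1) = F (l - 1)" by (rule qtorus_cancel_right[OF assms(2)])
    then show ?case using step2 by simp
  qed
  then show "G l = F l" by simp
qed

theorem proposition5p1:
  shows "\<exists>\<kappa>. algebra_iso \<kappa> A22 A_P1 \<and> (\<forall>l. \<kappa> (X_V l) = X_O (- l))"
proof -
  obtain \<phi> where iso: "algebra_iso \<phi> quantum_torus (\<phi> ` quantum_torus)"
    and \<phi>12: "\<phi> X\<^bsup>(0, 1)\<^esup> = X_O (- 1)" "\<phi> X\<^bsup>(1, 0)\<^esup> = X_O (- 2)"
    and mem: "\<And>l. X_O (- l) \<in> \<phi> ` quantum_torus"
    using embedding_exists by metis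
  have inj: "inj_on \<phi> quantum_torus" using iso by (simp add: algebra_iso_def bij_betw_def)
  \<comment> \<open>Pulled back along \<phi>, the generators keep their relations because \<phi> is
    injective.\<close>
  define F where "F l = inv_into quantum_torus \<phi> (X_O (- l))" for l
  have F: "F l \<in> quantum_torus" and \<phi>F: "\<phi> (F l) = X_O (- l)" for l
    unfolding F_def by (rule inv_into_into[OF mem], rule f_inv_into_f[OF mem])
  have one: "1 \<in> quantum_torus" using quantum_torus_subalgebra by (simp add: subalgebra_def)
  have "kronecker_family F"
    unfolding kronecker_family_def
  proof (intro conjI allI)
    show "F 1 = X\<^bsup>(0, 1)\<^esup>" "F 2 = X\<^bsup>(1, 0)\<^esup>"
      by (rule inj_onD[OF inj]; simp add: \<phi>F \<phi>12 F qmono_in_quantum_torus)+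
    fix l
    show "F (l - 2) * F l = \<nu>\<^bsup>2\<^esup> *\<^sub>\<nu> (F (l - 1))\<^sup>2 + 1"
    proof (rule inj_onD[OF inj])
      show "\<phi> (F (l - 2) * F l) = \<phi> (\<nu>\<^bsup>2\<^esup> *\<^sub>\<nu> (F (l - 1))\<^sup>2 + 1)"
        using iso X_O_exchange[of l] unfolding algebra_iso_def
        by (simp add: F \<phi>F one power2_eq_square quantum_torus_mult quantum_torus_scale)
    qed (simp_all add: F one power2_eq_square quantum_torus_mult quantum_torus_scale
        quantum_torus_add)
  qed (rule F)
  moreover have "F l \<noteq> 0" for l
  proof
    assume "F l = 0"
    then have "\<phi> (F l) = 0 *\<^sub>\<nu> \<phi> (F l)"
      using iso F[of l] unfolding algebra_iso_def by (metis qtorus.scale_zero_left)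
    then show False using X_O_nonzero[of l] by (simp add: \<phi>F)
  qed
  \<comment> \<open>Existence and uniqueness together resolve the definite description in
    \<open>X_V\<close>.\<close>
  ultimately have X_V: "X_V = F"
    unfolding X_V_def by (metis the_equality kronecker_family_unique)
  \<comment> \<open>Negation permutes the indices, so the reindexed generators still generate all of
    \<open>A_P1\<close>.\<close>
  have "range (\<lambda>l. X_O (- l)) = range X_O"
    by (metis image_image surj_uminus)
  then have "\<phi> ` range X_V = range X_O"
    by (simp add: X_V image_image \<phi>F)
  then have "algebra_iso \<phi> A22 A_P1"
    using algebra_iso_hull_image[OF iso quantum_torus_subalgebra, of "range X_V"] F
    unfolding A22_def A_P1_def by (simp add: X_V image_subset_iff)
  then show ?thesis using \<phi>F X_V by blast
qed

end
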